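(* Let $\mathbf{z}=(z_n)$ be a sequence in $\mathbb{D}$ that is regular with respect to $\mathfrak{u}\in\beta\mathbb{N}\setminus\mathbb{N}$. Then, for each $\mathbf{k}\in \mathtt{Comp}_{\mathfrak{u}}(\mathbf{z})$, the limits $\zeta_{\mathbf{z},\mathfrak{u}}^{\mathbf{k},0} := \lim_{r\to 0}\zeta_{\mathbf{z},\mathfrak{u}}^{\mathbf{k},r}$ and $\zeta_{\mathbf{z},\mathfrak{u}}^{\mathbf{k},1} := \lim_{r\to 1}\zeta_{\mathbf{z},\mathfrak{u}}^{\mathbf{k},r}$ exist and belong to $\mathfrak{M}$, and the closure in $\mathfrak{M}$ of $\left(\zeta_{\mathbf{z},\mathfrak{u}}^{\mathbf{k},0},\zeta_{\mathbf{z},\mathfrak{u}}^{\mathbf{k},1}\right) := \{\zeta_{\mathbf{z},\mathfrak{u}}^{\mathbf{k},r} : r\in(0,1)\}$ is $$\left(\zeta_{\mathbf{z},\mathfrak{u}}^{\mathbf{k},0},\zeta_{\mathbf{z},\mathfrak{u}}^{\mathbf{k},1}\right)\cup\left\{\zeta_{\mathbf{z},\mathfrak{u}}^{\mathbf{k},0},\zeta_{\mathbf{z},\mathfrak{u}}^{\mathbf{k},1}\right\}.$$ Moreover, this closure is homeomorphic to the interval $[0,1]$, through a homeomorphism sending $\left(\zeta_{\mathbf{z},\mathfrak{u}}^{\mathbf{k},0},\zeta_{\mathbf{z},\mathfrak{u}}^{\mathbf{k},1}\right)$ onto $(0,1)$.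
   Context: $\mathbb{K}$ is an algebraically closed field, complete with respect to a nontrivial nonarchimedean absolute value $|\cdot|$; $\mathbb{D} = \{z \in \mathbb{K} : |z|<1\}$; $\mathbb{N}=\{1,2,\dots\}$; $\beta\mathbb{N}\setminus\mathbb{N}$ is the set of nonprincipal ultrafilters in $\mathbb{N}$. $H^\infty$ is the Banach $\mathbb{K}$-algebra of bounded power series $f(z)=\sum_{n\ge 0} a_n z^n$ on $\mathbb{D}$, with norm $\|f\| = \sup_n |a_n| = \sup_{z\in\mathbb{D}}|f(z)|$. $\mathfrak{M}$ is the Berkovich space of $H^\infty$: the set of all maps $\varphi: H^\infty \to [0,\infty)$ with $\varphi(0)=0$, $\varphi(1)=1$, $\varphi(fg)=\varphi(f)\varphi(g)$, $\varphi(f+g)\le \varphi(f)+\varphi(g)$ and $\varphi(f)\le\|f\|$, with the topology of pointwise convergence (it is compact Hausdorff). $D^+(z,r)$ is the closed disk with center $z$ and radius $r$, and for a disk $D\subset\mathbb{D}$, $\zeta_D(f) := \sup_{z\in D}|f(z)|$, an element of $\mathfrak{M}$. A sequence $\mathbf{z}=(z_n)$ in $\mathbb{D}$ is regular with respect to $\mathfrak{u}$ if there is $C\in\mathfrak{u}$ with $\inf_{n\in C}\prod_{m\in C, m\ne n}|z_n-z_m|>0$. $\mathtt{Comp}_{\mathfrak{u}}(\mathbf{z})$ is the set of all sequences $\mathbf{k}=(k_n)$ in $\mathbb{N}$ for which there is $C\in\mathfrak{u}$ with $\inf_{n\in C}\prod_{m\in C, m\ne n}|z_n-z_m|^{k_m}>0$.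 For $\mathbf{k}\in\mathtt{Comp}_{\mathfrak{u}}(\mathbf{z})$ and $r\in(0,1)$, $\zeta_{\mathbf{z},\mathfrak{u}}^{\mathbf{k},r} := \lim_{\mathfrak{u}}\zeta_{D^+(z_n,\sqrt[k_n]{r})}\in\mathfrak{M}$ (pointwise limit along $\mathfrak{u}$). *)

theory Defs
  imports "HOL-Analysis.Analysis" "HOL-Computational_Algebra.Formal_Power_Series"
begin

text \<open>
  The library's normed fields are algebras over the reals, which excludes nonarchimedean fields, and
  it restricts \<^const>\<open>norm\<close> to such spaces. The absolute value is therefore a new class
  parameter. It inherits nonnegativity, definiteness and the triangle inequality from
  \<^const>\<open>dist\<close>; completeness and algebraic closedness are expressed by the library classes
  \<^class>\<open>complete_space\<close> and \<^class>\<open>alg_closed_field\<close>.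
\<close>

class nonarchimedean_field = field + metric_space +
  fixes absval :: "'a \<Rightarrow> real"
  assumes dist_absval: "dist x y = absval (x - y)"
    and absval_mult: "absval (x * y) = absval x * absval y"
    and absval_add_le_max: "absval (x + y) \<le> max (absval x) (absval y)"
    and absval_nontrivial: "\<exists>x. x \<noteq> 0 \<and> absval x \<noteq> 1"

definition Hinf :: "'a::nonarchimedean_field fps set" where
  "Hinf = {f. bdd_above (range (\<lambda>n. absval (fps_nth f n)))}"

definition Hinf_norm :: "'a::nonarchimedean_field fps \<Rightarrow> real" where
  "Hinf_norm f = (SUP n. absval (fps_nth f n))"

definition Hinf_eval :: "'a::nonarchimedean_field fps \<Rightarrow> 'a \<Rightarrow> 'a" where
  "Hinf_eval f z = (\<Sum>n. fps_nth f n * z ^ n)"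

text \<open>
  Maps \<open>H\<^sup>\<infinity> \<rightarrow> [0, \<infinity>)\<close> are represented by functions on all power series which are
  \<^const>\<open>undefined\<close> outside \<^const>\<open>Hinf\<close>, as in \<^const>\<open>product_topology\<close>.
\<close>

definition Berk :: "('a::nonarchimedean_field fps \<Rightarrow> real) set" where
  "Berk = {\<phi> \<in> extensional Hinf.
     (\<forall>f\<in>Hinf. 0 \<le> \<phi> f) \<and> \<phi> 0 = 0 \<and> \<phi> 1 = 1 \<and>
     (\<forall>f\<in>Hinf. \<forall>g\<in>Hinf. \<phi> (f * g) = \<phi> f * \<phi> g) \<and>
     (\<forall>f\<in>Hinf. \<forall>g\<in>Hinf. \<phi> (f + g) \<le> \<phi> f + \<phi> g) \<and>
     (\<forall>f\<in>Hinf. \<phi> f \<le> Hinf_norm f)}"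

definition Berk_topology :: "('a::nonarchimedean_field fps \<Rightarrow> real) topology" where
  "Berk_topology = subtopology (product_topology (\<lambda>_. euclideanreal) Hinf) Berk"

definition zeta_disk :: "'a::nonarchimedean_field set \<Rightarrow> 'a fps \<Rightarrow> real" where
  "zeta_disk D = (\<lambda>f\<in>Hinf. SUP z\<in>D. absval (Hinf_eval f z))"

text \<open>
  An ultrafilter is given as a filter \<open>u\<close>, where \<open>C \<in> u\<close> is written \<open>\<forall>\<^sub>F n in u. n \<in> C\<close>.
  The positive integers as index set of sequences are replaced by \<^typ>\<open>nat\<close>.
\<close>

definition nonprincipal_ultrafilter :: "'i filter \<Rightarrow> bool" where
  "nonprincipal_ultrafilter u \<longleftrightarrow>
     u \<noteq> bot \<and> (\<forall>P. eventually P u \<or> eventually (\<lambda>n. \<not> P n) u) \<and> (\<forall>n. u \<noteq> principal {n})"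

text \<open>
  The product over \<open>m \<in> C\<close>, \<open>m \<noteq> n\<close> is the limit of its partial products, which exists as
  the factors lie in \<open>[0, 1)\<close>; \<^const>\<open>prodinf\<close> is unsuitable because \<^const>\<open>has_prod\<close> does not
  accept products of nonzero factors that tend to \<open>0\<close>.
\<close>

definition weighted_separation ::
  "(nat \<Rightarrow> 'a::nonarchimedean_field) \<Rightarrow> (nat \<Rightarrow> nat) \<Rightarrow> nat set \<Rightarrow> nat \<Rightarrow> real" where
  "weighted_separation z k C n =
     lim (\<lambda>N. \<Prod>m\<in>{m \<in> C. m < N \<and> m \<noteq> n}. absval (z n - z m) ^ k m)"

definition regular_seq :: "nat filter \<Rightarrow> (nat \<Rightarrow> 'a::nonarchimedean_field) \<Rightarrow> bool" where
  "regular_seq u z \<longleftrightarrow>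
     (\<exists>C. (\<forall>\<^sub>F n in u. n \<in> C) \<and> 0 < (INF n\<in>C. weighted_separation z (\<lambda>_. 1) C n))"

definition compatible_seqs ::
  "nat filter \<Rightarrow> (nat \<Rightarrow> 'a::nonarchimedean_field) \<Rightarrow> (nat \<Rightarrow> nat) set" where
  "compatible_seqs u z =
     {k. (\<forall>n. 1 \<le> k n) \<and>
         (\<exists>C. (\<forall>\<^sub>F n in u. n \<in> C) \<and> 0 < (INF n\<in>C. weighted_separation z k C n))}"

definition zeta ::
  "(nat \<Rightarrow> 'a::nonarchimedean_field) \<Rightarrow> nat filter \<Rightarrow> (nat \<Rightarrow> nat) \<Rightarrow> real \<Rightarrow> 'a fps \<Rightarrow> real" where
  "zeta z u k r = (\<lambda>f\<in>Hinf. Lim u (\<lambda>n. zeta_disk (cball (z n) (root (k n) r)) f))"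

end

theory Submission
  imports Defs "HOL-Computational_Algebra.Polynomial_FPS"
begin

text \<open>
  Fix \<open>f\<close> in \<open>H\<^sup>\<infinity>\<close> and consider \<open>\<phi>(r)\<close>, the value at \<open>f\<close> of the ultralimit with parameter \<open>r\<close>.
  A polynomial splits into linear factors, and its supremum over \<open>D\<^sup>+(c, \<rho>)\<close> is the product of the
  suprema \<open>max \<bar>c - a\<bar> \<rho>\<close> of these factors. Hence such suprema are multiplicative, increasing in
  \<open>\<rho>\<close>, and convex as functions of \<open>ln \<rho>\<close>. Bounded power series are uniform limits of polynomials on
  disks of radius less than \<open>1\<close> and inherit all this (\<open>zeta_disk_in_Berk\<close>,
  \<open>convex_on_zeta_disk_exp\<close>). Multiplicativity, monotonicity and convexity are preserved by limits
  along \<open>u\<close>. Therefore \<open>\<phi>\<close> is bounded, increasing and, being convex in \<open>ln r\<close>, continuous on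
  \<open>(0, 1)\<close>; by monotonicity it has limits at \<open>0\<close> and \<open>1\<close>. This yields a continuous path
  from \<open>[0, 1]\<close> to the Berkovich space (\<open>zeta_extended_path\<close>). As \<open>[0, 1]\<close> is compact
  and the Berkovich space is Hausdorff, everything that is claimed follows once the path is injective
  (\<open>arc_in_Hausdorff_space\<close>).

  For injectivity a single \<open>f\<close> suffices whose \<open>\<phi>\<close> is strictly increasing. If \<open>f\<close> has a zero of order
  at least \<open>k\<^sub>n\<close> at \<open>z\<^sub>n\<close> for \<open>u\<close>-almost all \<open>n\<close>, then \<open>\<phi>(r) / r\<close> is increasing, and \<open>\<phi>\<close> is strictly
  increasing unless it vanishes somewhere. So the zeros have to be such that the cofactor of
  \<open>(x - z\<^sub>n) ^ k\<^sub>n\<close> stays away from \<open>0\<close> at \<open>z\<^sub>n\<close>, uniformly in \<open>n\<close>. Compatibility of \<open>k\<close> is this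
  condition for the formal product \<open>\<Prod>m. (1 - x / z\<^sub>m) ^ k\<^sub>m\<close>. That product need not converge, but it
  can be corrected by factors whose zeros keep away from all the \<open>z\<^sub>n\<close>
  (\<open>bounded_with_prescribed_zeros\<close>).
\<close>

section \<open>Nonarchimedean absolute values\<close>

lemma absval_nonneg [simp]: "0 \<le> absval (x::'a::nonarchimedean_field)"
  using dist_absval[of x 0] by (metis diff_zero zero_le_dist)

lemma absval_eq_0_iff [simp]: "absval (x::'a::nonarchimedean_field) = 0 \<longleftrightarrow> x = 0"
  using dist_absval[of x 0] by (metis diff_zero dist_eq_0_iff)

lemma absval_0 [simp]: "absval (0::'a::nonarchimedean_field) = 0"
  by simp

lemma absval_pos_iff [simp]: "0 < absval (x::'a::nonarchimedean_field) \<longleftrightarrow> x \<noteq> 0"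
  using absval_nonneg[of x] absval_eq_0_iff[of x] by linarith

lemma absval_1 [simp]: "absval (1::'a::nonarchimedean_field) = 1"
proof -
  have "absval (1::'a) * absval (1::'a) = absval (1::'a) * 1"
    using absval_mult[of "1::'a" 1] by simp
  then show ?thesis by (metis absval_eq_0_iff mult_left_cancel zero_neq_one)
qed

lemma absval_minus_commute: "absval (x - y) = absval (y - x :: 'a::nonarchimedean_field)"
  using dist_commute[of x y] by (simp add: dist_absval)

lemma absval_minus [simp]: "absval (- x) = absval (x :: 'a::nonarchimedean_field)"
  using absval_minus_commute[of 0 x] by simp

lemma absval_power: "absval (x ^ n) = absval (x :: 'a::nonarchimedean_field) ^ n"
  by (induction n) (auto simp: absval_mult)

lemma absval_prod: "absval (prod f A) = (\<Prod>x\<in>A. absval (f x :: 'a::nonarchimedean_field))"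
  by (induction A rule: infinite_finite_induct) (auto simp: absval_mult)

lemma absval_inverse: "absval (inverse x) = inverse (absval (x :: 'a::nonarchimedean_field))"
proof (cases "x = 0")
  case False
  then have "absval x * absval (inverse x) = 1"
    by (metis absval_1 absval_mult right_inverse)
  then show ?thesis by (metis inverse_unique)
qed auto

lemma absval_divide: "absval (x / y) = absval x / absval (y :: 'a::nonarchimedean_field)"
  by (simp add: divide_inverse absval_mult absval_inverse)

lemma absval_diff_le_max: "absval (x - y) \<le> max (absval x) (absval (y :: 'a::nonarchimedean_field))"
  using absval_add_le_max[of x "- y"] by simp

lemma absval_add_le: "absval x \<le> B \<Longrightarrow> absval y \<le> B \<Longrightarrow> absval (x + y :: 'a::nonarchimedean_field) \<le> B"
  using absval_add_le_max[of x y] by linarith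

lemma absval_diff_le: "absval x \<le> B \<Longrightarrow> absval y \<le> B \<Longrightarrow> absval (x - y :: 'a::nonarchimedean_field) \<le> B"
  using absval_diff_le_max[of x y] by linarith

lemma absval_sum_le:
  fixes f :: "'b \<Rightarrow> 'a::nonarchimedean_field"
  assumes "0 \<le> B" and "\<And>x. x \<in> A \<Longrightarrow> absval (f x) \<le> B"
  shows "absval (sum f A) \<le> B"
  using assms by (induction A rule: infinite_finite_induct) (auto intro: absval_add_le)

lemma absval_diff_eq_max:
  fixes x y :: "'a::nonarchimedean_field"
  assumes "absval x \<noteq> absval y"
  shows "absval (x - y) = max (absval x) (absval y)"
proof -
  have *: "absval (a - b) = absval a" if "absval b < absval a" for a b :: 'a
    using absval_diff_le_max[of a b] absval_add_le_max[of "a - b" b] that by simp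
  show ?thesis
    using *[of x y] *[of y x] assms absval_minus_commute[of x y]
    by (cases "absval x" "absval y" rule: linorder_cases) auto
qed

lemma absval_triangle_abs:
  "\<bar>absval x - absval y\<bar> \<le> absval (x - y :: 'a::nonarchimedean_field)"
  using dist_triangle[of x 0 y] dist_triangle[of y 0 x]
  by (simp add: dist_absval absval_minus_commute)

lemma mem_cball_absval: "x \<in> cball c \<rho> \<longleftrightarrow> absval (x - c :: 'a::nonarchimedean_field) \<le> \<rho>"
  by (simp add: dist_absval absval_minus_commute)

text \<open>
  Roots \<open>y\<close> of arbitrarily high order of an element of absolute value \<open>> 1\<close> have absolute value
  as close to \<open>1\<close> as desired, so that the powers of \<open>\<bar>y\<bar>\<close> cannot jump over a given interval.
\<close>

lemma absval_dense:
  fixes a b :: real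
  assumes "0 < a" "a < b"
  obtains x :: "'a::{nonarchimedean_field, alg_closed_field}" where "a < absval x" "absval x < b"
proof -
  obtain w0 :: 'a where w0: "w0 \<noteq> 0" "absval w0 \<noteq> 1"
    using absval_nontrivial by blast
  obtain w :: 'a where w: "1 < absval w"
  proof (cases "1 < absval w0")
    case False
    then show ?thesis
      using w0 that[of "inverse w0"] by (simp add: absval_inverse one_less_inverse_iff)
  qed (use that in auto)
  define L where "L = ln (absval w)"
  have L: "L > 0" unfolding L_def using w by (rule ln_gt_zero)
  define e where "e = ln b - ln a"
  have e: "e > 0" using assms by (simp add: e_def)
  obtain n :: nat where n: "L / e < real n" using reals_Archimedean2 by blast
  then have n0: "n > 0" using L e by (smt (verit) divide_pos_pos gr0I of_nat_0)
  obtain y where y: "y ^ n = w" using nth_root_exists[OF n0] by blast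
  have y0: "y \<noteq> 0" using y w n0 by (auto simp: absval_power power_0_left)
  define l where "l = ln (absval y)"
  have "L = real n * l" unfolding L_def l_def
    using y y0 by (metis absval_pos_iff absval_power ln_realpow)
  then have l: "l > 0" "l < e"
    using L n0 n e by (auto simp: zero_less_mult_iff field_simps)
  \<comment> \<open>The least integer \<open>m\<close> with \<open>\<bar>y\<bar>\<^sup>m > a\<close>.\<close>
  define m where "m = \<lfloor>ln a / l\<rfloor> + 1"
  have "ln a / l < of_int m" "of_int m \<le> ln a / l + 1" unfolding m_def by linarith+
  then have m: "ln a < of_int m * l" "of_int m * l \<le> ln a + l"
    using l by (auto simp: field_simps)
  define x where "x = (if m \<ge> 0 then y ^ nat m else inverse y ^ nat (- m))"
  have x0: "x \<noteq> 0" using y0 by (simp add: x_def)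
  have "ln (absval x) = of_int m * l"
    using y0 by (auto simp: x_def l_def absval_power absval_inverse ln_realpow ln_inverse)
  then have "ln a < ln (absval x)" "ln (absval x) < ln b"
    using m l by (auto simp: e_def)
  then show ?thesis using that[of x] x0 assms by simp
qed

lemma absval_dense_avoiding:
  fixes a b :: real
  assumes "0 < a" "a < b" "finite A"
  obtains x :: "'a::{nonarchimedean_field, alg_closed_field}"
  where "a < absval x" "absval x < b" "absval x \<notin> A"
proof -
  define a' where "a' = Max (insert a {y\<in>A. y < b})"
  have fin: "finite (insert a {y\<in>A. y < b})" using assms by auto
  have "a \<le> a'" unfolding a'_def using fin by auto
  moreover have "a' < b" unfolding a'_def using fin assms by (subst Max_less_iff) auto
  ultimately obtain x :: 'a where x: "a' < absval x" "absval x < b"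
    using absval_dense[of a' b] assms by (metis less_le_trans)
  have "absval x \<notin> A"
    using x fin Max_ge[of "insert a {y\<in>A. y < b}" "absval x"] by (auto simp: a'_def simp del: Max_insert)
  then show ?thesis using that x \<open>a \<le> a'\<close> by force
qed

section \<open>Suprema of polynomials on disks\<close>

definition poly_sup :: "'a::nonarchimedean_field \<Rightarrow> real \<Rightarrow> 'a poly \<Rightarrow> real" where
  "poly_sup c \<rho> p = (SUP z\<in>cball c \<rho>. absval (poly p z))"

lemma absval_poly_linear_factors:
  fixes b :: "'a::nonarchimedean_field"
  shows "absval (poly (smult b (\<Prod>a\<in>#A. [:-a, 1:])) z) = absval b * (\<Prod>a\<in>#A. absval (z - a))"
proof (induction A)
  case (add x A)
  have "poly (smult b (\<Prod>a\<in>#add_mset x A. [:-a, 1:])) z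
      = (z - x) * poly (smult b (\<Prod>a\<in>#A. [:-a, 1:])) z"
    by (simp add: mult.left_commute del: mult_pCons_left)
  with add show ?case by (simp add: absval_mult del: mult_pCons_left poly_smult)
qed simp

lemma prod_mset_max_nonneg: "0 \<le> \<rho> \<Longrightarrow> 0 \<le> (\<Prod>a\<in>#A. max (f a) (\<rho>::real))"
  by (induction A) (auto simp: zero_le_mult_iff)

lemma continuous_on_prod_mset_max:
  "continuous_on UNIV (\<lambda>\<rho>::real. \<Prod>a\<in>#A. max (f a) \<rho>)"
  by (induction A) (auto intro!: continuous_intros)

lemma convex_mono_prod_mset_max_exp:
  "convex_on UNIV (\<lambda>t::real. \<Prod>a\<in>#A. max (f a) (exp t)) \<and>
   mono (\<lambda>t::real. \<Prod>a\<in>#A. max (f a) (exp t))"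
proof (induction A)
  case empty
  show ?case by (simp add: convex_on_const mono_def)
next
  case (add x A)
  have 1: "convex_on UNIV (\<lambda>t. max (f x) (exp t))"
  proof (rule convex_onI)
    fix t r s :: real assume t: "0 < t" "t < 1"
    have "exp ((1 - t) *\<^sub>R r + t *\<^sub>R s) \<le> (1 - t) * exp r + t * exp s"
      using convex_onD[OF exp_convex, of t r s] t by simp
    also have "\<dots> \<le> (1 - t) * max (f x) (exp r) + t * max (f x) (exp s)"
      using t by (intro add_mono mult_left_mono) auto
    finally have "exp ((1 - t) *\<^sub>R r + t *\<^sub>R s) \<le> \<dots>" .
    moreover have "f x = (1 - t) * f x + t * f x" by (simp add: algebra_simps)
    moreover have "(1 - t) * f x + t * f x \<le> (1 - t) * max (f x) (exp r) + t * max (f x) (exp s)"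
      using t by (intro add_mono mult_left_mono) auto
    ultimately show "max (f x) (exp ((1 - t) *\<^sub>R r + t *\<^sub>R s))
        \<le> (1 - t) * max (f x) (exp r) + t * max (f x) (exp s)"
      by simp
  qed simp
  have 2: "mono (\<lambda>t. max (f x) (exp t))" by (auto simp: mono_def max.coboundedI2)
  have "convex_on UNIV (\<lambda>t. max (f x) (exp t) * (\<Prod>a\<in>#A. max (f a) (exp t)))"
    using add 1 2 by (intro convex_on_mul) (auto intro!: prod_mset_max_nonneg simp: max.coboundedI2)
  moreover have "mono (\<lambda>t. max (f x) (exp t) * (\<Prod>a\<in>#A. max (f a) (exp t)))"
  proof (rule monoI, rule mult_mono)
    fix r s :: real assume rs: "r \<le> s"
    show "max (f x) (exp r) \<le> max (f x) (exp s)" using monoD[OF 2 rs] .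
    show "(\<Prod>a\<in>#A. max (f a) (exp r)) \<le> (\<Prod>a\<in>#A. max (f a) (exp s))"
      using monoD[OF conjunct2[OF add] rs] .
    show "0 \<le> max (f x) (exp s)" by (simp add: max.coboundedI2)
    show "0 \<le> (\<Prod>a\<in>#A. max (f a) (exp r))" by (rule prod_mset_max_nonneg) simp
  qed
  ultimately show ?case by simp
qed

text \<open>
  On a circle about \<open>c\<close> whose radius \<open>\<sigma>\<close> is the absolute value of some element but differs from
  all the distances of \<open>c\<close> to the roots, every linear factor \<open>z - a\<close> has absolute value exactly
  \<open>max \<bar>c - a\<bar> \<sigma>\<close>. Such radii are dense, so the factors attain their suprema simultaneously,
  in the limit. This is the reason why the supremum is multiplicative.
\<close>

lemma poly_linear_factors_sup:
  fixes b c :: "'a::{nonarchimedean_field, alg_closed_field}" and A :: "'a multiset"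
  assumes "0 < \<rho>"
  defines "p \<equiv> smult b (\<Prod>a\<in>#A. [:-a, 1:])"
  shows "bdd_above ((\<lambda>z. absval (poly p z)) ` cball c \<rho>)"
    and "poly_sup c \<rho> p = absval b * (\<Prod>a\<in>#A. max (absval (c - a)) \<rho>)"
proof -
  define G where "G = (\<lambda>\<rho>. absval b * (\<Prod>a\<in>#A. max (absval (c - a)) \<rho>))"
  have upper: "absval (poly p z) \<le> G \<rho>" if "z \<in> cball c \<rho>" for z
  proof -
    have "absval (z - a) \<le> max (absval (c - a)) \<rho>" for a
      using that absval_add_le_max[of "z - c" "c - a"]
      by (auto simp: mem_cball_absval simp del: mem_cball)
    then have "(\<Prod>a\<in>#A. absval (z - a)) \<le> (\<Prod>a\<in>#A. max (absval (c - a)) \<rho>)"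
    proof (induction A)
      case (add x A)
      have "0 \<le> (\<Prod>a\<in>#A. absval (z - a))" by (induction A) auto
      then show ?case
        using add by (auto intro!: mult_mono simp: max.coboundedI1)
    qed auto
    then show ?thesis
      unfolding p_def G_def absval_poly_linear_factors by (intro mult_left_mono) auto
  qed
  then show bdd: "bdd_above ((\<lambda>z. absval (poly p z)) ` cball c \<rho>)"
    by (intro bdd_aboveI[of _ "G \<rho>"]) (auto simp del: mem_cball)
  have "G \<rho> \<le> poly_sup c \<rho> p"
  proof (rule ccontr)
    assume *: "\<not> G \<rho> \<le> poly_sup c \<rho> p"
    have "continuous_on UNIV G"
      unfolding G_def by (intro continuous_intros continuous_on_prod_mset_max)
    then have "G \<midarrow>\<rho>\<rightarrow> G \<rho>" by (simp add: continuous_on_def)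
    then have "eventually (\<lambda>\<sigma>. poly_sup c \<rho> p < G \<sigma>) (at_left \<rho>)"
      using * by (intro order_tendstoD) (auto simp: filterlim_at_split)
    then obtain \<rho>0 where \<rho>0: "\<rho>0 < \<rho>" "\<And>\<sigma>. \<rho>0 < \<sigma> \<Longrightarrow> \<sigma> < \<rho> \<Longrightarrow> poly_sup c \<rho> p < G \<sigma>"
      unfolding eventually_at_left_field by blast
    have "0 < max \<rho>0 (\<rho> / 2)" "max \<rho>0 (\<rho> / 2) < \<rho>" using assms(1) \<rho>0(1) by auto
    then obtain x :: 'a where x: "max \<rho>0 (\<rho> / 2) < absval x" "absval x < \<rho>"
        "absval x \<notin> (\<lambda>a. absval (c - a)) ` set_mset A"
      by (rule absval_dense_avoiding[where A = "(\<lambda>a. absval (c - a)) ` set_mset A"]) auto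
    have "absval ((c + x) - a) = max (absval (c - a)) (absval x)" if "a \<in># A" for a
    proof -
      have "absval (c - a) \<noteq> absval x" using x(3) that by (metis imageI)
      then have "absval ((c - a) - (- x)) = max (absval (c - a)) (absval (- x))"
        by (intro absval_diff_eq_max) auto
      then show ?thesis by (simp add: algebra_simps)
    qed
    then have "absval (poly p (c + x)) = G (absval x)"
      unfolding p_def G_def absval_poly_linear_factors
      by (intro arg_cong2[of _ _ _ _ "(*)"] arg_cong[of _ _ prod_mset] image_mset_cong) auto
    moreover have "absval (poly p (c + x)) \<le> poly_sup c \<rho> p"
      unfolding poly_sup_def using x bdd by (intro cSUP_upper) (auto simp: mem_cball_absval simp del: mem_cball)
    ultimately show False using \<rho>0(2)[of "absval x"] x by auto
  qed
  moreover have "poly_sup c \<rho> p \<le> G \<rho>"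
    unfolding poly_sup_def using upper assms(1) by (intro cSUP_least) auto
  ultimately show "poly_sup c \<rho> p = absval b * (\<Prod>a\<in>#A. max (absval (c - a)) \<rho>)"
    by (simp add: G_def)
qed

lemma poly_splits:
  fixes p :: "'a::alg_closed_field poly"
  obtains b A where "p = smult b (\<Prod>a\<in>#A. [:-a, 1:])"
proof (cases "p = 0")
  case True
  then show ?thesis using that[of 0 "{#}"] by simp
next
  case False
  then show ?thesis using alg_closed_imp_factorization[OF False] that by blast
qed

lemma bdd_above_poly_disk:
  fixes p :: "'a::{nonarchimedean_field, alg_closed_field} poly"
  assumes "0 < \<rho>"
  shows "bdd_above ((\<lambda>z. absval (poly p z)) ` cball c \<rho>)"
proof -
  obtain b A where "p = smult b (\<Prod>a\<in>#A. [:-a, 1:])" by (rule poly_splits)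
  then show ?thesis using poly_linear_factors_sup(1)[OF assms, where b = b and A = A] by simp
qed

lemma poly_sup_mult:
  fixes p q :: "'a::{nonarchimedean_field, alg_closed_field} poly"
  assumes "0 < \<rho>"
  shows "poly_sup c \<rho> (p * q) = poly_sup c \<rho> p * poly_sup c \<rho> q"
proof -
  obtain b A where p: "p = smult b (\<Prod>a\<in>#A. [:-a, 1:])" by (rule poly_splits)
  obtain d B where q: "q = smult d (\<Prod>a\<in>#B. [:-a, 1:])" by (rule poly_splits)
  have pq: "p * q = smult (b * d) (\<Prod>a\<in>#A + B. [:-a, 1:])" by (simp add: p q mult_ac)
  show ?thesis
    unfolding pq poly_linear_factors_sup(2)[OF assms] unfolding p q poly_linear_factors_sup(2)[OF assms]
    by (simp add: absval_mult)
qed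

lemma poly_sup_1:
  fixes c :: "'a::nonarchimedean_field"
  shows "0 \<le> \<rho> \<Longrightarrow> poly_sup c \<rho> 1 = 1"
  by (simp add: poly_sup_def)

lemma poly_sup_power:
  fixes p :: "'a::{nonarchimedean_field, alg_closed_field} poly"
  assumes "0 < \<rho>"
  shows "poly_sup c \<rho> (p ^ n) = poly_sup c \<rho> p ^ n"
  using assms by (induction n) (auto simp: poly_sup_1 poly_sup_mult)

lemma poly_sup_ge_center:
  fixes p :: "'a::{nonarchimedean_field, alg_closed_field} poly"
  assumes "0 < \<rho>"
  shows "absval (poly p c) \<le> poly_sup c \<rho> p"
  unfolding poly_sup_def using assms by (intro cSUP_upper bdd_above_poly_disk) auto

lemma poly_sup_mono:
  fixes p :: "'a::{nonarchimedean_field, alg_closed_field} poly"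
  assumes "0 < \<rho>" "\<rho> \<le> \<sigma>"
  shows "poly_sup c \<rho> p \<le> poly_sup c \<sigma> p"
  unfolding poly_sup_def using assms by (intro cSUP_subset_mono bdd_above_poly_disk) auto

lemma poly_sup_linear_center:
  fixes c :: "'a::{nonarchimedean_field, alg_closed_field}"
  assumes "0 < \<rho>" "c \<noteq> 0"
  shows "poly_sup c \<rho> [:1, - inverse c:] = \<rho> / absval c"
proof -
  have "[:1, - inverse c:] = smult (- inverse c) (\<Prod>a\<in>#{#c#}. [:-a, 1:])"
    using assms by simp
  then show ?thesis
    using assms by (simp only: poly_linear_factors_sup(2)) (simp add: absval_inverse divide_inverse mult.commute)
qed

lemma convex_on_poly_sup_exp:
  fixes p :: "'a::{nonarchimedean_field, alg_closed_field} poly"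
  shows "convex_on UNIV (\<lambda>t. poly_sup c (exp t) p)"
proof -
  obtain b A where p: "p = smult b (\<Prod>a\<in>#A. [:-a, 1:])" by (rule poly_splits)
  show ?thesis
    unfolding p poly_linear_factors_sup(2)[OF exp_gt_zero]
    by (intro convex_on_cmul conjunct1[OF convex_mono_prod_mset_max_exp]) auto
qed

section \<open>Bounded power series and their values on disks\<close>

definition coeffs_le :: "'a::nonarchimedean_field fps \<Rightarrow> real \<Rightarrow> bool" where
  "coeffs_le f B \<longleftrightarrow> (\<forall>n. absval (fps_nth f n) \<le> B)"

lemma coeffs_leD: "coeffs_le f B \<Longrightarrow> absval (fps_nth f n) \<le> B"
  by (simp add: coeffs_le_def)

lemma coeffs_le_nonneg: "coeffs_le f B \<Longrightarrow> 0 \<le> B"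
  using coeffs_leD[of f B 0] absval_nonneg order_trans by blast

lemma coeffs_le_mono: "coeffs_le f B \<Longrightarrow> B \<le> B' \<Longrightarrow> coeffs_le f B'"
  unfolding coeffs_le_def using order_trans by blast

lemma coeffs_le_0 [simp]: "0 \<le> B \<Longrightarrow> coeffs_le 0 B"
  by (simp add: coeffs_le_def)

lemma coeffs_le_add: "coeffs_le f B \<Longrightarrow> coeffs_le g B \<Longrightarrow> coeffs_le (f + g) B"
  by (simp add: coeffs_le_def absval_add_le)

lemma coeffs_le_mult:
  assumes "coeffs_le f A" "coeffs_le g B"
  shows "coeffs_le (f * g) (A * B)"
  unfolding coeffs_le_def fps_mult_nth
  using assms by (auto intro!: absval_sum_le mult_mono simp: absval_mult coeffs_le_nonneg coeffs_leD)

lemma coeffs_le_1: "coeffs_le 1 1"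
  by (simp add: coeffs_le_def)

lemma coeffs_le_power: "coeffs_le f B \<Longrightarrow> coeffs_le (f ^ n) (B ^ n)"
  by (induction n) (auto intro: coeffs_le_mult coeffs_le_1)

lemma coeffs_le_prod:
  "(\<And>x. x \<in> A \<Longrightarrow> coeffs_le (f x) (B x)) \<Longrightarrow> coeffs_le (prod f A) (prod B A)"
  by (induction A rule: infinite_finite_induct) (auto intro: coeffs_le_mult coeffs_le_1)

lemma coeffs_le_cutoff: "coeffs_le f B \<Longrightarrow> coeffs_le (fps_cutoff n f) B"
  using coeffs_le_nonneg[of f B] by (auto simp: coeffs_le_def)

lemma Hinf_iff: "f \<in> Hinf \<longleftrightarrow> (\<exists>B. coeffs_le f B)"
  by (auto simp: Hinf_def bdd_above_def coeffs_le_def)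

lemma HinfI: "coeffs_le f B \<Longrightarrow> f \<in> Hinf"
  by (auto simp: Hinf_iff)

lemma coeffs_le_Hinf_norm: "f \<in> Hinf \<Longrightarrow> coeffs_le f (Hinf_norm f)"
  unfolding coeffs_le_def Hinf_norm_def Hinf_def by (auto intro: cSUP_upper)

lemma Hinf_add: "f \<in> Hinf \<Longrightarrow> g \<in> Hinf \<Longrightarrow> f + g \<in> Hinf"
  using coeffs_le_Hinf_norm[of f] coeffs_le_Hinf_norm[of g]
  by (intro HinfI[of _ "max (Hinf_norm f) (Hinf_norm g)"] coeffs_le_add) (auto intro: coeffs_le_mono)

lemma Hinf_mult: "f \<in> Hinf \<Longrightarrow> g \<in> Hinf \<Longrightarrow> f * g \<in> Hinf"
  by (rule HinfI, rule coeffs_le_mult) (rule coeffs_le_Hinf_norm; assumption)+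

lemma Hinf_0 [simp]: "0 \<in> Hinf" and Hinf_1 [simp]: "1 \<in> Hinf"
  by (rule HinfI[of _ 1], simp, rule HinfI, rule coeffs_le_1)

lemma Hinf_sums:
  fixes z :: "'a::{nonarchimedean_field, complete_space}"
  assumes f: "coeffs_le f B" and z: "absval z < 1"
  shows "(\<lambda>N. \<Sum>n<N. fps_nth f n * z ^ n) \<longlonglongrightarrow> Hinf_eval f z"
proof -
  define S where "S = (\<lambda>N. \<Sum>n<N. fps_nth f n * z ^ n)"
  have B: "0 \<le> B" by (rule coeffs_le_nonneg[OF f])
  have tail: "absval (S n - S N) \<le> B * absval z ^ N" if "N \<le> n" for n N
  proof -
    have "S n - S N = (\<Sum>i\<in>{N..<n}. fps_nth f i * z ^ i)"
      unfolding S_def using that by (metis lessThan_atLeast0 sum_diff_nat_ivl zero_le)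
    also have "absval \<dots> \<le> B * absval z ^ N"
    proof (rule absval_sum_le)
      fix i assume "i \<in> {N..<n}"
      then have "absval z ^ i \<le> absval z ^ N" using z by (intro power_decreasing) auto
      then show "absval (fps_nth f i * z ^ i) \<le> B * absval z ^ N"
        using f B by (auto simp: absval_mult absval_power intro!: mult_mono coeffs_leD)
    qed (use B in auto)
    finally show ?thesis .
  qed
  have lim: "(\<lambda>N. B * absval z ^ N) \<longlonglongrightarrow> 0"
    using z by (auto intro!: tendsto_eq_intros LIMSEQ_realpow_zero)
  have "Cauchy S"
  proof (rule metric_CauchyI)
    fix e :: real assume "0 < e"
    then obtain N where N: "B * absval z ^ N < e"
      using order_tendstoD(2)[OF lim] by (metis eventually_sequentially order_refl)
    have "dist (S m) (S n) < e" if "m \<ge> N" "n \<ge> N" for m n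
    proof -
      have "S m - S n = (S m - S N) - (S n - S N)" by simp
      then have "absval (S m - S n) \<le> B * absval z ^ N"
        using tail that by (metis absval_diff_le)
      then show ?thesis using N by (simp add: dist_absval)
    qed
    then show "\<exists>M. \<forall>m\<ge>M. \<forall>n\<ge>M. dist (S m) (S n) < e" by blast
  qed
  then have "convergent S" by (rule Cauchy_convergent)
  then have "summable (\<lambda>n. fps_nth f n * z ^ n)"
    unfolding convergent_def summable_def sums_def S_def .
  then show ?thesis unfolding Hinf_eval_def by (rule summable_LIMSEQ)
qed

lemma Hinf_eval_poly: "Hinf_eval (fps_of_poly p) z = poly p (z::'a::nonarchimedean_field)"
proof -
  have "(\<lambda>n. coeff p n * z ^ n) sums (\<Sum>n\<le>degree p. coeff p n * z ^ n)"
    unfolding sums_def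
  proof (rule tendsto_eventually)
    show "eventually (\<lambda>N. (\<Sum>n<N. coeff p n * z ^ n) = (\<Sum>n\<le>degree p. coeff p n * z ^ n)) sequentially"
      using eventually_gt_at_top[of "degree p"]
      by eventually_elim (auto intro!: sum.mono_neutral_right le_degree)
  qed
  then show ?thesis by (simp add: Hinf_eval_def poly_altdef sums_iff)
qed

text \<open>
  This estimate reduces all statements about values of bounded power series on a disk of radius
  less than \<open>1\<close> to polynomials, uniformly on the disk.
\<close>

lemma Hinf_eval_diff_le:
  fixes z :: "'a::{nonarchimedean_field, complete_space}"
  assumes f: "coeffs_le f B" and g: "coeffs_le g B" and z: "absval z < 1"
    and eq: "fps_cutoff N f = fps_cutoff N g"
  shows "absval (Hinf_eval f z - Hinf_eval g z) \<le> B * absval z ^ N"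
proof -
  have B: "0 \<le> B" by (rule coeffs_le_nonneg[OF f])
  define S where "S = (\<lambda>f M. \<Sum>n<M. fps_nth f n * z ^ n)"
  have "absval (S f M - S g M) \<le> B * absval z ^ N" for M
  proof -
    have "S f M - S g M = (\<Sum>n<M. (fps_nth f n - fps_nth g n) * z ^ n)"
      by (simp add: S_def sum_subtractf left_diff_distrib)
    also have "absval \<dots> \<le> B * absval z ^ N"
    proof (rule absval_sum_le)
      fix n
      show "absval ((fps_nth f n - fps_nth g n) * z ^ n) \<le> B * absval z ^ N"
      proof (cases "n < N")
        case True
        then have "fps_nth f n = fps_nth g n" using eq by (simp add: fps_cutoff_eq_fps_cutoff_iff)
        then show ?thesis using B by simp
      next
        case False
        then have "absval z ^ n \<le> absval z ^ N" using z by (intro power_decreasing) auto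
        then show ?thesis
          using f g B by (auto simp: absval_mult absval_power intro!: mult_mono absval_diff_le coeffs_leD)
      qed
    qed (use B in auto)
    finally show ?thesis .
  qed
  then have le: "dist (S f M) (S g M) \<le> B * absval z ^ N" for M by (simp add: dist_absval)
  have "(\<lambda>M. dist (S f M) (S g M)) \<longlonglongrightarrow> dist (Hinf_eval f z) (Hinf_eval g z)"
    unfolding S_def by (intro tendsto_dist Hinf_sums[OF f z] Hinf_sums[OF g z])
  then have "dist (Hinf_eval f z) (Hinf_eval g z) \<le> B * absval z ^ N"
    using le by (intro LIMSEQ_le_const2) auto
  then show ?thesis by (simp add: dist_absval)
qed

lemma absval_Hinf_eval_le:
  fixes z :: "'a::{nonarchimedean_field, complete_space}"
  assumes "coeffs_le f B" "absval z < 1"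
  shows "absval (Hinf_eval f z) \<le> B"
proof -
  have "Hinf_eval 0 z = 0" using Hinf_eval_poly[of 0 z] by simp
  then show ?thesis
    using Hinf_eval_diff_le[of f B 0 z 0] assms coeffs_le_nonneg[of f B] by simp
qed

lemma zeta_disk_poly:
  fixes c :: "'a::{nonarchimedean_field, complete_space}"
  shows "zeta_disk (cball c \<rho>) (fps_of_poly p) = poly_sup c \<rho> p"
proof -
  obtain B where B: "\<forall>y\<in>(\<lambda>n. absval (coeff p n)) ` {..degree p}. y \<le> B"
    using finite_imageI[OF finite_atMost, of "\<lambda>n. absval (coeff p n)" "degree p"]
    by (metis bdd_above_finite bdd_above_def)
  have "absval (coeff p n) \<le> max 0 B" for n
  proof (cases "n \<le> degree p")
    case True
    then show ?thesis using B by (auto intro: max.coboundedI2)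
  qed (auto simp: coeff_eq_0)
  then have "fps_of_poly p \<in> Hinf"
    by (intro HinfI[of _ "max 0 B"]) (simp only: coeffs_le_def fps_of_poly_nth, blast)
  then show ?thesis by (simp add: zeta_disk_def poly_sup_def Hinf_eval_poly)
qed

text \<open>
  The uniform bound on the coefficients turns coefficientwise approximation into uniform
  approximation on each disk of radius less than \<open>1\<close>.
\<close>

definition poly_approx :: "(nat \<Rightarrow> 'a::nonarchimedean_field poly) \<Rightarrow> 'a fps \<Rightarrow> bool" where
  "poly_approx p f \<longleftrightarrow> (\<exists>B. coeffs_le f B \<and> (\<forall>N. coeffs_le (fps_of_poly (p N)) B)) \<and>
     (\<forall>N. fps_cutoff N (fps_of_poly (p N)) = fps_cutoff N f)"

lemma poly_approxE:
  assumes "poly_approx p f"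
  obtains B where "coeffs_le f B" "\<And>N. coeffs_le (fps_of_poly (p N)) B"
    "\<And>N. fps_cutoff N (fps_of_poly (p N)) = fps_cutoff N f"
  using assms unfolding poly_approx_def by auto

lemma poly_approx_truncate:
  assumes "f \<in> Hinf"
  shows "poly_approx (\<lambda>N. truncate_fps N f) f"
proof -
  from assms have "coeffs_le f (Hinf_norm f)" by (rule coeffs_le_Hinf_norm)
  then show ?thesis
    unfolding poly_approx_def by (auto simp: coeffs_le_cutoff fps_cutoff_eq_fps_cutoff_iff intro!: exI[of _ "Hinf_norm f"])
qed

lemma poly_approx_mult:
  assumes "poly_approx p f" "poly_approx q g"
  shows "poly_approx (\<lambda>N. p N * q N) (f * g)"
proof -
  obtain A where A: "coeffs_le f A" "\<And>N. coeffs_le (fps_of_poly (p N)) A"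
    "\<And>N. fps_cutoff N (fps_of_poly (p N)) = fps_cutoff N f"
    using poly_approxE[OF assms(1)] by metis
  obtain B where B: "coeffs_le g B" "\<And>N. coeffs_le (fps_of_poly (q N)) B"
    "\<And>N. fps_cutoff N (fps_of_poly (q N)) = fps_cutoff N g"
    using poly_approxE[OF assms(2)] by metis
  have "fps_nth (fps_of_poly (p N) * fps_of_poly (q N)) n = fps_nth (f * g) n" if "n < N" for n N
    using A(3)[of N] B(3)[of N] that
    by (metis fps_cutoff_left_mult_nth fps_cutoff_right_mult_nth)
  then show ?thesis
    unfolding poly_approx_def
    using A B by (auto simp: fps_of_poly_mult coeffs_le_mult fps_cutoff_eq_fps_cutoff_iff intro!: exI[of _ "A * B"])
qed

lemma poly_approx_add:
  assumes "poly_approx p f" "poly_approx q g"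
  shows "poly_approx (\<lambda>N. p N + q N) (f + g)"
proof -
  obtain A where A: "coeffs_le f A" "\<And>N. coeffs_le (fps_of_poly (p N)) A"
    "\<And>N. fps_cutoff N (fps_of_poly (p N)) = fps_cutoff N f"
    using poly_approxE[OF assms(1)] by metis
  obtain B where B: "coeffs_le g B" "\<And>N. coeffs_le (fps_of_poly (q N)) B"
    "\<And>N. fps_cutoff N (fps_of_poly (q N)) = fps_cutoff N g"
    using poly_approxE[OF assms(2)] by metis
  have "coeffs_le (f + g) (max A B)" "coeffs_le (fps_of_poly (p N + q N)) (max A B)" for N
    unfolding fps_of_poly_add using A B by (auto intro!: coeffs_le_add
      coeffs_le_mono[OF A(1)] coeffs_le_mono[OF A(2)] coeffs_le_mono[OF B(1)] coeffs_le_mono[OF B(2)])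
  then show ?thesis
    unfolding poly_approx_def using A(3) B(3)
    by (auto simp: fps_of_poly_add fps_cutoff_add)
qed

lemma poly_approx_tendsto_zeta_disk:
  fixes c :: "'a::{nonarchimedean_field, complete_space, alg_closed_field}"
  assumes p: "poly_approx p f" and c: "absval c < 1" and \<rho>: "0 < \<rho>" "\<rho> < 1"
  shows "(\<lambda>N. poly_sup c \<rho> (p N)) \<longlonglongrightarrow> zeta_disk (cball c \<rho>) f"
proof -
  obtain B where B: "coeffs_le f B" "\<And>N. coeffs_le (fps_of_poly (p N)) B"
    "\<And>N. fps_cutoff N (fps_of_poly (p N)) = fps_cutoff N f"
    using poly_approxE[OF p] by metis
  have B0: "0 \<le> B" by (rule coeffs_le_nonneg[OF B(1)])
  define \<sigma> where "\<sigma> = max (absval c) \<rho>"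
  have \<sigma>: "0 \<le> \<sigma>" "\<sigma> < 1" using c \<rho> by (auto simp: \<sigma>_def)
  have in_disk: "absval z \<le> \<sigma>" if "z \<in> cball c \<rho>" for z
    using that absval_add_le_max[of "z - c" c] by (auto simp: \<sigma>_def mem_cball_absval simp del: mem_cball)
  let ?F = "\<lambda>z. absval (Hinf_eval f z)" and ?P = "\<lambda>N z. absval (poly (p N) z)"
  have diff: "\<bar>?P N z - ?F z\<bar> \<le> B * \<sigma> ^ N" if "z \<in> cball c \<rho>" for N z
  proof -
    have z: "absval z < 1" using in_disk[OF that] \<sigma> by linarith
    have "\<bar>?P N z - ?F z\<bar> \<le> absval (poly (p N) z - Hinf_eval f z)" by (rule absval_triangle_abs)
    also have "\<dots> \<le> B * absval z ^ N"
      using Hinf_eval_diff_le[OF B(2) B(1) z B(3), of N] by (simp add: Hinf_eval_poly)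
    also have "\<dots> \<le> B * \<sigma> ^ N"
      using B0 in_disk[OF that] by (intro mult_left_mono power_mono) auto
    finally show ?thesis .
  qed
  have ne: "cball c \<rho> \<noteq> {}" using \<rho> by auto
  have bddF: "bdd_above (?F ` cball c \<rho>)"
    using absval_Hinf_eval_le[OF B(1)] in_disk \<sigma> by (intro bdd_aboveI[of _ B]) fastforce
  have zf: "zeta_disk (cball c \<rho>) f = (SUP z\<in>cball c \<rho>. ?F z)"
    using B(1) by (simp add: zeta_disk_def HinfI)
  have "dist (poly_sup c \<rho> (p N)) (zeta_disk (cball c \<rho>) f) \<le> B * \<sigma> ^ N" for N
  proof -
    have "(SUP z\<in>cball c \<rho>. ?P N z) \<le> (SUP z\<in>cball c \<rho>. ?F z) + B * \<sigma> ^ N"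
    proof (rule cSUP_least[OF ne])
      fix z assume z: "z \<in> cball c \<rho>"
      have "?F z \<le> (SUP z\<in>cball c \<rho>. ?F z)" by (rule cSUP_upper[OF z bddF])
      then show "?P N z \<le> (SUP z\<in>cball c \<rho>. ?F z) + B * \<sigma> ^ N" using diff[OF z, of N] by linarith
    qed
    moreover have "(SUP z\<in>cball c \<rho>. ?F z) \<le> (SUP z\<in>cball c \<rho>. ?P N z) + B * \<sigma> ^ N"
    proof (rule cSUP_least[OF ne])
      fix z assume z: "z \<in> cball c \<rho>"
      have "?P N z \<le> (SUP z\<in>cball c \<rho>. ?P N z)"
        by (rule cSUP_upper[OF z bdd_above_poly_disk[OF \<rho>(1)]])
      then show "?F z \<le> (SUP z\<in>cball c \<rho>. ?P N z) + B * \<sigma> ^ N" using diff[OF z, of N] by linarith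
    qed
    ultimately show ?thesis by (simp add: zf poly_sup_def dist_real_def abs_le_iff)
  qed
  moreover have "(\<lambda>N. B * \<sigma> ^ N) \<longlonglongrightarrow> 0"
    using \<sigma> by (auto intro!: tendsto_eq_intros LIMSEQ_realpow_zero)
  ultimately show ?thesis
    by (subst tendsto_dist_iff) (rule tendsto_sandwich[of "\<lambda>_. 0"], auto)
qed

lemma tendsto_zeta_disk_truncate:
  fixes c :: "'a::{nonarchimedean_field, complete_space, alg_closed_field}"
  assumes "f \<in> Hinf" "absval c < 1" "0 < \<rho>" "\<rho> < 1"
  shows "(\<lambda>N. poly_sup c \<rho> (truncate_fps N f)) \<longlonglongrightarrow> zeta_disk (cball c \<rho>) f"
  using assms by (intro poly_approx_tendsto_zeta_disk poly_approx_truncate)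

lemma zeta_disk_mono:
  fixes c :: "'a::{nonarchimedean_field, complete_space, alg_closed_field}"
  assumes "f \<in> Hinf" "absval c < 1" "0 < \<rho>" "\<rho> \<le> \<sigma>" "\<sigma> < 1"
  shows "zeta_disk (cball c \<rho>) f \<le> zeta_disk (cball c \<sigma>) f"
  by (rule LIMSEQ_le[OF tendsto_zeta_disk_truncate tendsto_zeta_disk_truncate])
     (use assms in \<open>auto intro: poly_sup_mono\<close>)

text \<open>
  Products of nonnegative increasing convex functions are convex, so that this weak form of
  Hadamard's three circles theorem passes from linear factors to polynomials, and from these to
  power series by approximation.
\<close>

lemma convex_on_zeta_disk_exp:
  fixes c :: "'a::{nonarchimedean_field, complete_space, alg_closed_field}"
  assumes "f \<in> Hinf" "absval c < 1"
  shows "convex_on {..<0} (\<lambda>t. zeta_disk (cball c (exp t)) f)"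
proof (rule convex_onI)
  fix t x y :: real assume t: "0 < t" "t < 1" and xy: "x \<in> {..<0}" "y \<in> {..<0}"
  let ?w = "(1 - t) *\<^sub>R x + t *\<^sub>R y"
  have w: "?w \<in> {..<0}" using convexD[of "{..<0::real}" x y "1 - t" t] t xy by auto
  have lim: "(\<lambda>N. poly_sup c (exp s) (truncate_fps N f)) \<longlonglongrightarrow> zeta_disk (cball c (exp s)) f"
    if "s \<in> {..<0}" for s using that assms by (intro tendsto_zeta_disk_truncate) auto
  show "zeta_disk (cball c (exp ?w)) f
      \<le> (1 - t) * zeta_disk (cball c (exp x)) f + t * zeta_disk (cball c (exp y)) f"
    using t convex_onD[OF convex_on_poly_sup_exp, of t x y]
    by (intro LIMSEQ_le[OF lim[OF w] tendsto_add[OF tendsto_mult_left[OF lim[OF xy(1)]]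
      tendsto_mult_left[OF lim[OF xy(2)]]]]) auto
qed simp

lemma poly_sup_add:
  fixes p q :: "'a::{nonarchimedean_field, alg_closed_field} poly"
  assumes "0 < \<rho>"
  shows "poly_sup c \<rho> (p + q) \<le> poly_sup c \<rho> p + poly_sup c \<rho> q"
  unfolding poly_sup_def
proof (rule cSUP_least)
  fix z assume z: "z \<in> cball c \<rho>"
  have "absval (poly (p + q) z) \<le> absval (poly p z) + absval (poly q z)"
    using absval_add_le_max[of "poly p z" "poly q z"] absval_nonneg[of "poly p z"] absval_nonneg[of "poly q z"]
    unfolding poly_add by linarith
  then show "absval (poly (p + q) z)
      \<le> (SUP z\<in>cball c \<rho>. absval (poly p z)) + (SUP z\<in>cball c \<rho>. absval (poly q z))"
    using cSUP_upper[OF z bdd_above_poly_disk[OF assms], of p]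
      cSUP_upper[OF z bdd_above_poly_disk[OF assms], of q] by linarith
qed (use assms in auto)

lemma zeta_disk_in_Berk:
  fixes c :: "'a::{nonarchimedean_field, complete_space, alg_closed_field}"
  assumes c: "absval c < 1" and \<rho>: "0 < \<rho>" "\<rho> < 1"
  shows "zeta_disk (cball c \<rho>) \<in> Berk"
  unfolding Berk_def
proof (intro CollectI conjI ballI)
  let ?\<zeta> = "zeta_disk (cball c \<rho>)"
  note tr = poly_approx_truncate
  note lim = poly_approx_tendsto_zeta_disk[OF _ c \<rho>]
  show "?\<zeta> \<in> extensional Hinf" by (simp add: zeta_disk_def)
  show "?\<zeta> 0 = 0" using zeta_disk_poly[of c \<rho> 0] \<rho> by (simp add: poly_sup_def)
  show "?\<zeta> 1 = 1" using zeta_disk_poly[of c \<rho> 1] \<rho> by (simp add: poly_sup_def)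
  fix f :: "'a fps" assume f: "f \<in> Hinf"
  show "0 \<le> ?\<zeta> f"
    by (rule LIMSEQ_le_const[OF lim[OF tr[OF f]]])
       (auto intro!: exI[of _ 0] order_trans[OF absval_nonneg poly_sup_ge_center[OF \<rho>(1)]])
  have "absval z < 1" if "z \<in> cball c \<rho>" for z
    using that c \<rho> absval_add_le_max[of "z - c" c] by (auto simp: mem_cball_absval simp del: mem_cball)
  then show "?\<zeta> f \<le> Hinf_norm f"
    unfolding zeta_disk_def restrict_apply'[OF f] using \<rho>
    by (intro cSUP_least absval_Hinf_eval_le coeffs_le_Hinf_norm f) auto
  fix g :: "'a fps" assume g: "g \<in> Hinf"
  have "(\<lambda>N. poly_sup c \<rho> (truncate_fps N f) * poly_sup c \<rho> (truncate_fps N g)) \<longlonglongrightarrow> ?\<zeta> (f * g)"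
    unfolding poly_sup_mult[OF \<rho>(1), symmetric] by (intro lim poly_approx_mult tr f g)
  then show "?\<zeta> (f * g) = ?\<zeta> f * ?\<zeta> g"
    by (rule LIMSEQ_unique[OF _ tendsto_mult[OF lim[OF tr[OF f]] lim[OF tr[OF g]]]])
  show "?\<zeta> (f + g) \<le> ?\<zeta> f + ?\<zeta> g"
    by (rule LIMSEQ_le[OF lim[OF poly_approx_add[OF tr[OF f] tr[OF g]]]
        tendsto_add[OF lim[OF tr[OF f]] lim[OF tr[OF g]]]])
       (auto intro: poly_sup_add \<rho>)
qed

section \<open>The path of ultralimits\<close>

lemma Berk_limit:
  assumes F: "F \<noteq> bot" and B: "eventually (\<lambda>i. \<phi> i \<in> Berk) F"
    and ext: "\<psi> \<in> extensional Hinf"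
    and lim: "\<And>f. f \<in> Hinf \<Longrightarrow> ((\<lambda>i. \<phi> i f) \<longlongrightarrow> \<psi> f) F"
  shows "\<psi> \<in> Berk"
proof -
  have ev: "eventually (\<lambda>i. P (\<phi> i)) F" if "\<And>\<phi>. \<phi> \<in> Berk \<Longrightarrow> P \<phi>" for P
    using B by (rule eventually_mono) (use that in blast)
  have "0 \<le> \<psi> f" "\<psi> f \<le> Hinf_norm f" if "f \<in> Hinf" for f
    using that by (auto intro!: tendsto_lowerbound[OF lim _ F] tendsto_upperbound[OF lim _ F]
        ev[where P = "\<lambda>\<phi>. 0 \<le> \<phi> f"] ev[where P = "\<lambda>\<phi>. \<phi> f \<le> Hinf_norm f"] simp: Berk_def)
  moreover have "((\<lambda>i. \<phi> i 0) \<longlongrightarrow> 0) F" "((\<lambda>i. \<phi> i 1) \<longlongrightarrow> 1) F"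
    using ev[where P = "\<lambda>\<phi>. \<phi> 0 = 0"] ev[where P = "\<lambda>\<phi>. \<phi> 1 = 1"]
    by (auto simp: Berk_def intro!: tendsto_eventually)
  then have "\<psi> 0 = 0" "\<psi> 1 = 1" using lim[of 0] lim[of 1] tendsto_unique[OF F] by auto
  moreover have "\<psi> (f * g) = \<psi> f * \<psi> g" if fg: "f \<in> Hinf" "g \<in> Hinf" for f g
  proof -
    have "eventually (\<lambda>i. \<phi> i (f * g) = \<phi> i f * \<phi> i g) F"
      by (rule ev) (use fg in \<open>auto simp: Berk_def\<close>)
    then have "((\<lambda>i. \<phi> i f * \<phi> i g) \<longlongrightarrow> \<psi> (f * g)) F"
      by (rule Lim_transform_eventually[OF lim[OF Hinf_mult[OF fg]]])
    then show ?thesis by (rule tendsto_unique[OF F _ tendsto_mult[OF lim[OF fg(1)] lim[OF fg(2)]]])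
  qed
  moreover have "\<psi> (f + g) \<le> \<psi> f + \<psi> g" if fg: "f \<in> Hinf" "g \<in> Hinf" for f g
    using fg by (intro tendsto_le[OF F tendsto_add[OF lim[OF fg(1)] lim[OF fg(2)]] lim[OF Hinf_add[OF fg]]] ev)
      (auto simp: Berk_def)
  ultimately show ?thesis using ext by (auto simp: Berk_def)
qed

text \<open>
  By compactness the values have a cluster point along \<open>u\<close>, and an ultrafilter converges to each of
  its cluster points.
\<close>

lemma ultrafilter_bounded_convergent:
  fixes X :: "'i \<Rightarrow> real"
  assumes u: "nonprincipal_ultrafilter u" and X: "\<And>n. a \<le> X n" "\<And>n. X n \<le> b"
  shows "\<exists>l. (X \<longlongrightarrow> l) u"
proof -
  let ?F = "filtermap X u"
  have "?F \<noteq> bot" using u by (simp add: nonprincipal_ultrafilter_def filtermap_bot_iff)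
  moreover have "eventually (\<lambda>x. x \<in> {a..b}) ?F" using X by (simp add: eventually_filtermap)
  ultimately obtain l where l: "inf (nhds l) ?F \<noteq> bot"
    using compact_Icc[of a b, unfolded compact_filter] by blast
  have "(X \<longlongrightarrow> l) u"
  proof (rule topological_tendstoI, rule ccontr)
    fix S assume S: "open S" "l \<in> S" and "\<not> eventually (\<lambda>n. X n \<in> S) u"
    then have "eventually (\<lambda>n. X n \<notin> S) u"
      using u unfolding nonprincipal_ultrafilter_def by blast
    then have "eventually (\<lambda>x. x \<notin> S) ?F" by (simp add: eventually_filtermap)
    moreover have "eventually (\<lambda>x. x \<in> S) (nhds l)" using S by (rule eventually_nhds_in_open)
    ultimately have "eventually (\<lambda>x. False) (inf (nhds l) ?F)"
      unfolding eventually_inf by blast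
    then show False using l by (simp add: trivial_limit_def)
  qed
  then show ?thesis ..
qed

lemma mono_bounded_limits:
  fixes f :: "real \<Rightarrow> real"
  assumes mono: "\<And>r s. 0 < r \<Longrightarrow> r \<le> s \<Longrightarrow> s < 1 \<Longrightarrow> f r \<le> f s"
    and bound: "\<And>r. 0 < r \<Longrightarrow> r < 1 \<Longrightarrow> a \<le> f r" "\<And>r. 0 < r \<Longrightarrow> r < 1 \<Longrightarrow> f r \<le> b"
  shows "\<exists>l. (f \<longlongrightarrow> l) (at_right 0)" and "\<exists>l. (f \<longlongrightarrow> l) (at_left 1)"
proof -
  let ?S = "f ` {0<..<1}"
  have ne: "?S \<noteq> {}" by auto
  have below: "bdd_below ?S" and above: "bdd_above ?S"
    using bound by (auto intro!: bdd_belowI[of _ a] bdd_aboveI[of _ b])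
  have "(f \<longlongrightarrow> Inf ?S) (at_right 0)"
  proof (rule order_tendstoI)
    fix y assume y: "y < Inf ?S"
    have "eventually (\<lambda>x::real. x \<in> {0<..<1}) (at_right 0)" by (rule eventually_at_rightI) auto
    then show "eventually (\<lambda>x. y < f x) (at_right 0)"
    proof eventually_elim
      case (elim x)
      then show ?case using cInf_lower[OF _ below, of "f x"] y by force
    qed
  next
    fix y assume "Inf ?S < y"
    then obtain r where r: "0 < r" "r < 1" "f r < y" using cInf_less_iff[OF ne below] by auto
    have "eventually (\<lambda>x::real. x \<in> {0<..<r}) (at_right 0)"
      using r by (intro eventually_at_rightI[of _ r]) auto
    then show "eventually (\<lambda>x. f x < y) (at_right 0)"
    proof eventually_elim
      case (elim x)
      then show ?case using mono[of x r] r by auto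
    qed
  qed
  then show "\<exists>l. (f \<longlongrightarrow> l) (at_right 0)" ..
  have "(f \<longlongrightarrow> Sup ?S) (at_left 1)"
  proof (rule order_tendstoI)
    fix y assume y: "Sup ?S < y"
    have "eventually (\<lambda>x::real. x \<in> {0<..<1}) (at_left 1)" by (rule eventually_at_leftI[of 0]) auto
    then show "eventually (\<lambda>x. f x < y) (at_left 1)"
    proof eventually_elim
      case (elim x)
      then show ?case using cSup_upper[OF _ above, of "f x"] y by force
    qed
  next
    fix y assume "y < Sup ?S"
    then obtain r where r: "0 < r" "r < 1" "y < f r" using less_cSup_iff[OF ne above] by auto
    have "eventually (\<lambda>x::real. x \<in> {r<..<1}) (at_left 1)"
      using r by (intro eventually_at_leftI[of r]) auto
    then show "eventually (\<lambda>x. y < f x) (at_left 1)"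
    proof eventually_elim
      case (elim x)
      then show ?case using mono[of r x] r by auto
    qed
  qed
  then show "\<exists>l. (f \<longlongrightarrow> l) (at_left 1)" ..
qed

context
  fixes z :: "nat \<Rightarrow> 'a::{nonarchimedean_field, complete_space, alg_closed_field}"
    and u :: "nat filter" and k :: "nat \<Rightarrow> nat"
  assumes u: "nonprincipal_ultrafilter u"
    and z: "\<And>n. absval (z n) < 1"
    and k: "\<And>n. 1 \<le> k n"
begin

lemma root_weight_in_unit: "0 < r \<Longrightarrow> r < 1 \<Longrightarrow> 0 < root (k n) r \<and> root (k n) r < 1"
  using k[of n] by auto

lemma zeta_disk_seq_in_Berk:
  "0 < r \<Longrightarrow> r < 1 \<Longrightarrow> zeta_disk (cball (z n) (root (k n) r)) \<in> Berk"
  using root_weight_in_unit by (intro zeta_disk_in_Berk z) auto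

lemma zeta_tendsto:
  assumes f: "f \<in> Hinf" and r: "0 < r" "r < 1"
  shows "((\<lambda>n. zeta_disk (cball (z n) (root (k n) r)) f) \<longlongrightarrow> zeta z u k r f) u"
proof -
  have "\<exists>l. ((\<lambda>n. zeta_disk (cball (z n) (root (k n) r)) f) \<longlongrightarrow> l) u"
    using zeta_disk_seq_in_Berk[OF r] f
    by (intro ultrafilter_bounded_convergent[OF u, of 0 _ "Hinf_norm f"]) (auto simp: Berk_def)
  then obtain l where l: "((\<lambda>n. zeta_disk (cball (z n) (root (k n) r)) f) \<longlongrightarrow> l) u" ..
  have "u \<noteq> bot" using u by (simp add: nonprincipal_ultrafilter_def)
  then have "zeta z u k r f = l" using tendsto_Lim[OF _ l] f by (simp add: zeta_def)
  then show ?thesis using l by simp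
qed

lemma zeta_in_Berk:
  assumes r: "0 < r" "r < 1"
  shows "zeta z u k r \<in> Berk"
proof (rule Berk_limit)
  show "u \<noteq> bot" using u by (simp add: nonprincipal_ultrafilter_def)
  show "eventually (\<lambda>n. zeta_disk (cball (z n) (root (k n) r)) \<in> Berk) u"
    using zeta_disk_seq_in_Berk[OF r] by simp
  show "zeta z u k r \<in> extensional Hinf" by (simp add: zeta_def)
qed (rule zeta_tendsto[OF _ r])

lemma zeta_mono:
  assumes f: "f \<in> Hinf" and r: "0 < r" "r \<le> s" "s < 1"
  shows "zeta z u k r f \<le> zeta z u k s f"
proof (rule tendsto_le)
  show "u \<noteq> bot" using u by (simp add: nonprincipal_ultrafilter_def)
  show "((\<lambda>n. zeta_disk (cball (z n) (root (k n) r)) f) \<longlongrightarrow> zeta z u k r f) u"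
    "((\<lambda>n. zeta_disk (cball (z n) (root (k n) s)) f) \<longlongrightarrow> zeta z u k s f) u"
    using f r by (auto intro!: zeta_tendsto)
  have "root (k n) r \<le> root (k n) s" for n using k[of n] r by simp
  then show "eventually (\<lambda>n. zeta_disk (cball (z n) (root (k n) r)) f
      \<le> zeta_disk (cball (z n) (root (k n) s)) f) u"
    using r f root_weight_in_unit[of r] root_weight_in_unit[of s]
    by (intro always_eventually allI zeta_disk_mono z) auto
qed

text \<open>
  The exponent \<open>1 / k\<^sub>n\<close> is a linear change of the variable \<open>ln r\<close>, and so convexity is preserved for
  each \<open>n\<close>. In contrast to continuity, it passes to the limit along \<open>u\<close>.
\<close>

lemma convex_on_zeta_exp:
  assumes f: "f \<in> Hinf"
  shows "convex_on {..<0} (\<lambda>t. zeta z u k (exp t) f)"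
proof (rule convex_onI)
  fix t x y :: real assume t: "0 < t" "t < 1" and xy: "x \<in> {..<0}" "y \<in> {..<0}"
  define w where "w = (1 - t) *\<^sub>R x + t *\<^sub>R y"
  have w: "w \<in> {..<0}"
    unfolding w_def using convexD[of "{..<0::real}" x y "1 - t" t] t xy by auto
  have root_exp: "root (k n) (exp s) = exp (s / k n)" for s :: real and n
    using k[of n] by (intro real_root_pos_unique) (auto simp: exp_of_nat_mult[symmetric])
  have neg: "s / k n \<in> {..<0}" if "s \<in> {..<0}" for s n
    using that k[of n] by (auto simp: divide_neg_pos)
  have lim: "((\<lambda>n. zeta_disk (cball (z n) (root (k n) (exp s))) f) \<longlongrightarrow> zeta z u k (exp s) f) u"
    if "s \<in> {..<0}" for s using that f by (intro zeta_tendsto) auto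
  have "zeta_disk (cball (z n) (root (k n) (exp w))) f
      \<le> (1 - t) * zeta_disk (cball (z n) (root (k n) (exp x))) f
        + t * zeta_disk (cball (z n) (root (k n) (exp y))) f" for n
  proof -
    have "w / k n = (1 - t) *\<^sub>R (x / k n) + t *\<^sub>R (y / k n)"
      by (simp add: w_def add_divide_distrib)
    then show ?thesis
      unfolding root_exp
      using convex_onD[OF convex_on_zeta_disk_exp[OF f z[of n]], of t "x / k n" "y / k n"] t
        neg[OF xy(1), of n] neg[OF xy(2), of n] by simp
  qed
  then have "zeta z u k (exp w) f \<le> (1 - t) * zeta z u k (exp x) f + t * zeta z u k (exp y) f"
    using u unfolding nonprincipal_ultrafilter_def
    by (intro tendsto_le[OF _ tendsto_add[OF tendsto_mult_left[OF lim[OF xy(1)]]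
      tendsto_mult_left[OF lim[OF xy(2)]]] lim[OF w]]) auto
  then show "zeta z u k (exp ((1 - t) *\<^sub>R x + t *\<^sub>R y)) f
      \<le> (1 - t) * zeta z u k (exp x) f + t * zeta z u k (exp y) f" by (simp add: w_def)
qed simp

lemma continuous_on_zeta:
  assumes f: "f \<in> Hinf"
  shows "continuous_on {0<..<1} (\<lambda>r. zeta z u k r f)"
proof -
  have "continuous_on {..<0} (\<lambda>t. zeta z u k (exp t) f)"
    by (rule convex_on_continuous[OF open_lessThan convex_on_zeta_exp[OF f]])
  then have "continuous_on {0<..<1} (\<lambda>r. zeta z u k (exp (ln r)) f)"
    by (rule continuous_on_compose2) (auto intro!: continuous_intros)
  then show ?thesis by (rule continuous_on_eq) simp
qed

text \<open>
  In the interior continuity comes from convexity; at the ends monotonicity supplies the limits, and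
  these lie in the Berkovich space because its defining conditions are closed.
\<close>

lemma zeta_extended_path:
  obtains \<gamma> where "\<And>r. 0 < r \<Longrightarrow> r < 1 \<Longrightarrow> \<gamma> r = zeta z u k r"
    and "\<And>r. 0 \<le> r \<Longrightarrow> r \<le> 1 \<Longrightarrow> \<gamma> r \<in> Berk"
    and "\<And>f. f \<in> Hinf \<Longrightarrow> continuous_on {0..1} (\<lambda>r. \<gamma> r f)"
    and "continuous_map (top_of_set {0..1}) Berk_topology \<gamma>"
proof -
  have bounds: "0 \<le> zeta z u k r f" "zeta z u k r f \<le> Hinf_norm f"
    if "f \<in> Hinf" "0 < r" "r < 1" for f r using zeta_in_Berk[OF that(2,3)] that(1) by (auto simp: Berk_def)
  have "\<exists>l. ((\<lambda>r. zeta z u k r f) \<longlongrightarrow> l) (at_right 0)" if "f \<in> Hinf" for f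
    using that by (intro mono_bounded_limits[of _ 0 "Hinf_norm f"] zeta_mono bounds)
  then obtain L0 where L0: "\<And>f. f \<in> Hinf \<Longrightarrow> ((\<lambda>r. zeta z u k r f) \<longlongrightarrow> L0 f) (at_right 0)" by metis
  have "\<exists>l. ((\<lambda>r. zeta z u k r f) \<longlongrightarrow> l) (at_left 1)" if "f \<in> Hinf" for f
    using that by (intro mono_bounded_limits[of _ 0 "Hinf_norm f"] zeta_mono bounds)
  then obtain L1 where L1: "\<And>f. f \<in> Hinf \<Longrightarrow> ((\<lambda>r. zeta z u k r f) \<longlongrightarrow> L1 f) (at_left 1)" by metis
  define \<gamma> where "\<gamma> = (\<lambda>r. if r = 0 then restrict L0 Hinf else if r = 1 then restrict L1 Hinf else zeta z u k r)"
  have near0: "eventually (\<lambda>r::real. 0 < r \<and> r < 1) (at_right 0)"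
    by (rule eventually_at_rightI[of _ 1]) auto
  have near1: "eventually (\<lambda>r::real. 0 < r \<and> r < 1) (at_left 1)"
    by (rule eventually_at_leftI[of 0]) auto
  have mid: "\<gamma> r = zeta z u k r" if "0 < r" "r < 1" for r using that by (simp add: \<gamma>_def)
  have 0: "\<gamma> 0 \<in> Berk"
    by (rule Berk_limit[of "at_right 0" "zeta z u k"])
       (use near0 L0 in \<open>auto simp: \<gamma>_def elim!: eventually_mono intro: zeta_in_Berk\<close>)
  have 1: "\<gamma> 1 \<in> Berk"
    by (rule Berk_limit[of "at_left 1" "zeta z u k"])
       (use near1 L1 in \<open>auto simp: \<gamma>_def elim!: eventually_mono intro: zeta_in_Berk\<close>)
  have B: "\<gamma> r \<in> Berk" if "0 \<le> r" "r \<le> 1" for r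
    using that 0 1 zeta_in_Berk[of r] mid[of r] by (cases "r = 0"; cases "r = 1") auto
  have cont: "continuous_on {0..1} (\<lambda>r. \<gamma> r f)" if f: "f \<in> Hinf" for f
  proof (rule continuous_on_IccI)
    show "((\<lambda>r. \<gamma> r f) \<longlongrightarrow> \<gamma> 0 f) (at_right 0)"
      using L0[OF f] f by (rule_tac Lim_transform_eventually[OF _ eventually_mono[OF near0]])
        (auto simp: \<gamma>_def)
    show "((\<lambda>r. \<gamma> r f) \<longlongrightarrow> \<gamma> 1 f) (at_left 1)"
      using L1[OF f] f by (rule_tac Lim_transform_eventually[OF _ eventually_mono[OF near1]])
        (auto simp: \<gamma>_def)
    fix r :: real assume r: "0 < r" "r < 1"
    have "continuous_on {0<..<1} (\<lambda>r. \<gamma> r f)"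
      by (rule continuous_on_eq[OF continuous_on_zeta[OF f]]) (simp add: mid)
    then show "(\<lambda>r. \<gamma> r f) \<midarrow>r\<rightarrow> \<gamma> r f"
      using r by (simp add: continuous_on_eq_continuous_at isCont_def)
  qed simp
  have "continuous_map (top_of_set {0..1}) Berk_topology \<gamma>"
    unfolding Berk_topology_def continuous_map_in_subtopology continuous_map_componentwise
    using B cont by (auto simp: Berk_def)
  with that mid B cont show ?thesis by blast
qed

end

lemma arc_in_Hausdorff_space:
  fixes \<gamma> :: "real \<Rightarrow> 'b"
  assumes X: "Hausdorff_space X" and cont: "continuous_map (top_of_set {0..1}) X \<gamma>"
    and inj: "inj_on \<gamma> {0..1}"
  shows "X closure_of (\<gamma> ` {0<..<1}) = \<gamma> ` {0..1}"
    and "\<exists>h. homeomorphic_map (subtopology X (\<gamma> ` {0..1})) (top_of_set {0..1::real}) h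
      \<and> h ` (\<gamma> ` {0<..<1}) = {0<..<1}"
    and "limitin X \<gamma> (\<gamma> 0) (at_right 0)" and "limitin X \<gamma> (\<gamma> 1) (at_left 1)"
proof -
  let ?I = "top_of_set {0..1::real}"
  have sub: "\<gamma> ` {0..1} \<subseteq> topspace X" using cont by (auto simp: continuous_map_def)
  have comp: "compact_space ?I" by (simp add: compact_space_subtopology)
  have "compactin X (\<gamma> ` {0..1})"
    by (rule image_compactin[OF _ cont]) (simp add: compactin_subtopology)
  then have closed: "closedin X (\<gamma> ` {0..1})" by (rule compactin_imp_closedin[OF X])
  have "?I closure_of {0<..<1} = {0..1}"
    by (simp add: closure_of_subtopology Int_absorb1 greaterThanLessThan_subseteq_atLeastAtMost_iff)
  then have "\<gamma> ` {0..1} \<subseteq> X closure_of (\<gamma> ` {0<..<1})"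
    using continuous_map_image_closure_subset[OF cont, of "{0<..<1}"] by simp
  moreover have "X closure_of (\<gamma> ` {0<..<1}) \<subseteq> \<gamma> ` {0..1}"
    by (rule closure_of_minimal[OF _ closed]) auto
  ultimately show "X closure_of (\<gamma> ` {0<..<1}) = \<gamma> ` {0..1}" by blast
  have "homeomorphic_map ?I (subtopology X (\<gamma> ` {0..1})) \<gamma>"
    using cont comp X inj sub
    by (intro continuous_imp_homeomorphic_map Hausdorff_space_subtopology)
      (auto simp: continuous_map_in_subtopology)
  then obtain h where h: "homeomorphic_maps ?I (subtopology X (\<gamma> ` {0..1})) \<gamma> h"
    by (auto simp: homeomorphic_map_maps)
  then have "h (\<gamma> r) = r" if "r \<in> {0..1}" for r
    using that by (auto simp: homeomorphic_maps_def)
  then have "h ` (\<gamma> ` {0<..<1}) = {0<..<1}" unfolding image_image by force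
  then show "\<exists>h. homeomorphic_map (subtopology X (\<gamma> ` {0..1})) ?I h \<and> h ` (\<gamma> ` {0<..<1}) = {0<..<1}"
    using h unfolding homeomorphic_maps_map by blast
  have lim: "limitin X \<gamma> (\<gamma> r) F" if r: "r \<in> {0..1}" and F: "filterlim id (nhds r) F"
    "eventually (\<lambda>x. x \<in> {0..1}) F" for r F
    unfolding limitin_def
  proof (intro conjI allI impI)
    show "\<gamma> r \<in> topspace X" using sub r by auto
    fix U assume U: "openin X U \<and> \<gamma> r \<in> U"
    then have "openin ?I {x \<in> {0..1}. \<gamma> x \<in> U}"
      using openin_continuous_map_preimage[OF cont, of U] by simp
    then obtain T where T: "open T" "{x \<in> {0..1}. \<gamma> x \<in> U} = {0..1} \<inter> T"
      unfolding openin_open by blast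
    have "eventually (\<lambda>x. x \<in> T) F"
      using topological_tendstoD[OF F(1) T(1)] T(2) r U by auto
    with F(2) show "eventually (\<lambda>x. \<gamma> x \<in> U) F"
      by eventually_elim (use T(2) in blast)
  qed
  show "limitin X \<gamma> (\<gamma> 0) (at_right 0)"
    by (rule lim) (auto simp: id_def intro: eventually_at_rightI[of _ 1])
  show "limitin X \<gamma> (\<gamma> 1) (at_left 1)"
    by (rule lim) (auto simp: id_def intro: eventually_at_leftI[of 0])
qed

section \<open>Bounded functions with prescribed zeros\<close>

text \<open>
  Such a series has absolute value \<open>1\<close> throughout the open disk of radius \<open>1 / R\<close>, which is why this
  class is closed under inversion.
\<close>

definition geom_bounded :: "real \<Rightarrow> 'a::nonarchimedean_field fps \<Rightarrow> bool" where
  "geom_bounded R f \<longleftrightarrow> fps_nth f 0 = 1 \<and> (\<forall>n. absval (fps_nth f n) \<le> R ^ n)"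

lemma geom_bounded_mult:
  assumes "geom_bounded R f" "geom_bounded R g" "0 \<le> R"
  shows "geom_bounded R (f * g)"
proof -
  have "absval (fps_nth f i * fps_nth g (n - i)) \<le> R ^ n" if "i \<le> n" for i n
  proof -
    have "absval (fps_nth f i * fps_nth g (n - i)) \<le> R ^ i * R ^ (n - i)"
      unfolding absval_mult using assms by (intro mult_mono) (auto simp: geom_bounded_def)
    also have "\<dots> = R ^ n" using that by (simp flip: power_add)
    finally show ?thesis .
  qed
  then show ?thesis
    using assms by (auto simp: geom_bounded_def fps_mult_nth intro!: absval_sum_le)
qed

lemma geom_bounded_1: "0 \<le> R \<Longrightarrow> geom_bounded R 1"
  by (simp add: geom_bounded_def)

lemma geom_bounded_power: "geom_bounded R f \<Longrightarrow> 0 \<le> R \<Longrightarrow> geom_bounded R (f ^ n)"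
  by (induction n) (auto intro: geom_bounded_mult geom_bounded_1)

lemma geom_bounded_prod:
  "(\<And>x. x \<in> A \<Longrightarrow> geom_bounded R (f x)) \<Longrightarrow> 0 \<le> R \<Longrightarrow> geom_bounded R (prod f A)"
  by (induction A rule: infinite_finite_induct) (auto intro: geom_bounded_mult geom_bounded_1)

lemma geom_bounded_inverse:
  fixes f :: "'a::nonarchimedean_field fps"
  assumes f: "geom_bounded R f" and R: "0 \<le> R"
  shows "geom_bounded R (inverse f)"
proof -
  let ?g = "inverse f"
  have f0: "fps_nth f 0 = 1" using f by (simp add: geom_bounded_def)
  have fg: "f * ?g = 1" using f0 by (intro inverse_mult_eq_1') simp
  have "absval (fps_nth ?g n) \<le> R ^ n" for n
  proof (induction n rule: less_induct)
    case (less n)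
    show ?case
    proof (cases "n = 0")
      case False
      have "0 = (\<Sum>i=0..n. fps_nth f i * fps_nth ?g (n - i))"
        using arg_cong[OF fg, of "\<lambda>h. fps_nth h n"] False by (simp add: fps_mult_nth)
      also have "\<dots> = fps_nth ?g n + (\<Sum>i=Suc 0..n. fps_nth f i * fps_nth ?g (n - i))"
        by (subst sum.atLeast_Suc_atMost) (auto simp: f0)
      finally have "fps_nth ?g n = - (\<Sum>i=Suc 0..n. fps_nth f i * fps_nth ?g (n - i))"
        by (metis eq_neg_iff_add_eq_0)
      moreover have "absval (\<Sum>i=Suc 0..n. fps_nth f i * fps_nth ?g (n - i)) \<le> R ^ n"
      proof (rule absval_sum_le)
        fix i assume i: "i \<in> {Suc 0..n}"
        have "absval (fps_nth f i * fps_nth ?g (n - i)) \<le> R ^ i * R ^ (n - i)"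
          unfolding absval_mult using f i R less.IH[of "n - i"]
          by (intro mult_mono) (auto simp: geom_bounded_def)
        also have "\<dots> = R ^ n" using i by (simp flip: power_add)
        finally show "absval (fps_nth f i * fps_nth ?g (n - i)) \<le> R ^ n" .
      qed (use R in auto)
      ultimately show ?thesis by simp
    qed (simp add: f0)
  qed
  then show ?thesis using f0 by (simp add: geom_bounded_def)
qed

text \<open>
  The hypothesis keeps the zeros of \<open>P\<close> out of the open disk of radius \<open>\<bar>w\<bar>\<close>. Truncating the series
  of \<open>1 / P\<close> would create zeros of unknown position. With the additional term \<open>(x / w)\<^sup>N\<close> they are all
  on the circle of radius \<open>\<bar>w\<bar>\<close>: inside it the constant term \<open>1\<close> of \<open>Q\<close> dominates, outside it the
  additional term does.
\<close>

lemma correction_factor: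
  fixes P :: "'a::nonarchimedean_field poly" and w :: 'a
  assumes w: "w \<noteq> 0" "absval w \<le> 1" and P: "geom_bounded (1 / absval w) (fps_of_poly P)"
  obtains Q where "fps_cutoff N (fps_of_poly (P * Q)) = fps_cutoff N 1"
    and "coeffs_le (fps_of_poly Q) ((1 / absval w) ^ N)"
    and "\<And>x. absval x \<noteq> absval w \<Longrightarrow> 1 \<le> absval (poly Q x)"
proof -
  define R where "R = 1 / absval w"
  have R: "1 \<le> R" using w by (simp add: R_def)
  define g where "g = inverse (fps_of_poly P)"
  have g: "geom_bounded R g" unfolding g_def using geom_bounded_inverse[OF P] by (simp add: R_def)
  have Pg: "fps_of_poly P * g = 1"
    unfolding g_def using P by (intro inverse_mult_eq_1') (simp add: geom_bounded_def)
  define Q where "Q = truncate_fps N g + monom (inverse w ^ N) N"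
  have coeff_Q: "coeff Q i = (if i < N then fps_nth g i else if i = N then inverse w ^ N else 0)" for i
    by (simp add: Q_def coeff_truncate_fps)
  have "fps_cutoff N (fps_of_poly Q) = fps_cutoff N g"
    by (simp add: fps_cutoff_eq_fps_cutoff_iff coeff_Q)
  then have "fps_nth (fps_of_poly P * fps_of_poly Q) i = fps_nth 1 i" if "i < N" for i
    using that fps_cutoff_right_mult_nth[of i N "fps_of_poly P"] Pg by metis
  then have 1: "fps_cutoff N (fps_of_poly (P * Q)) = fps_cutoff N 1"
    by (simp add: fps_cutoff_eq_fps_cutoff_iff fps_of_poly_mult)
  have "absval (coeff Q i) \<le> R ^ N" for i
  proof (cases "i < N")
    case True
    then have "absval (coeff Q i) \<le> R ^ i" using g by (simp add: coeff_Q geom_bounded_def)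
    also have "\<dots> \<le> R ^ N" using True R by (intro power_increasing) auto
    finally show ?thesis .
  next
    case False
    then show ?thesis
      using R by (auto simp: coeff_Q absval_power absval_inverse R_def divide_inverse)
  qed
  then have 2: "coeffs_le (fps_of_poly Q) ((1 / absval w) ^ N)" by (simp add: coeffs_le_def R_def)
  have 3: "1 \<le> absval (poly Q x)" if x: "absval x \<noteq> absval w" for x
  proof (cases "N = 0")
    case True
    then show ?thesis by (simp add: Q_def poly_monom)
  next
    case N: False
    define t where "t = R * absval x"
    have t: "0 \<le> t" using R by (simp add: t_def)
    have t1: "t \<noteq> 1" using x w by (auto simp: t_def R_def field_simps)
    have term_le: "absval (fps_nth g i * x ^ i) \<le> t ^ i" for i
      using g by (auto simp: absval_mult absval_power t_def power_mult_distrib geom_bounded_def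
          intro!: mult_right_mono)
    have top: "absval ((inverse w * x) ^ N) = t ^ N"
      by (simp add: absval_mult absval_power absval_inverse t_def R_def divide_inverse)
    have "poly (truncate_fps N g) x = (\<Sum>i<N. fps_nth g i * x ^ i)"
    proof -
      have "poly (truncate_fps N g) x = (\<Sum>i\<le>degree (truncate_fps N g). coeff (truncate_fps N g) i * x ^ i)"
        by (rule poly_altdef)
      also have "\<dots> = (\<Sum>i<N. coeff (truncate_fps N g) i * x ^ i)"
        using degree_truncate_fps[of N g] N
        by (intro sum.mono_neutral_left) (auto simp: coeff_eq_0)
      finally show ?thesis by simp
    qed
    then have Qx: "poly Q x = (\<Sum>i<N. fps_nth g i * x ^ i) + (inverse w * x) ^ N"
      by (simp add: Q_def poly_monom power_mult_distrib)
    show ?thesis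
    proof (cases "t < 1")
      case True
      have "(\<Sum>i<N. fps_nth g i * x ^ i) = 1 + (\<Sum>i\<in>{1..<N}. fps_nth g i * x ^ i)"
        using N g by (simp add: lessThan_atLeast0 sum.atLeast_Suc_lessThan geom_bounded_def)
      then have *: "poly Q x = 1 - (- (\<Sum>i\<in>{1..<N}. fps_nth g i * x ^ i) - (inverse w * x) ^ N)"
        using Qx by simp
      have le_t: "t ^ i \<le> t" if "1 \<le> i" for i
        using power_decreasing[of 1 i t] that True t by simp
      have "absval (\<Sum>i\<in>{1..<N}. fps_nth g i * x ^ i) \<le> t"
        using t term_le le_t by (intro absval_sum_le) (auto intro: order_trans)
      then have "absval (- (\<Sum>i\<in>{1..<N}. fps_nth g i * x ^ i) - (inverse w * x) ^ N) \<le> t"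
        using N le_t[of N] top by (intro absval_diff_le) auto
      then show ?thesis unfolding * using True by (subst absval_diff_eq_max) auto
    next
      case False
      then have t1: "1 < t" using t1 by simp
      have "absval (\<Sum>i<N. fps_nth g i * x ^ i) \<le> t ^ (N - 1)"
        using t1 term_le N by (intro absval_sum_le) (auto intro!: order_trans[OF term_le] power_increasing)
      also have "\<dots> < t ^ N" using t1 N by (intro power_strict_increasing) auto
      finally have lt: "absval (\<Sum>i<N. fps_nth g i * x ^ i) < t ^ N" .
      have *: "poly Q x = (\<Sum>i<N. fps_nth g i * x ^ i) - (- ((inverse w * x) ^ N))" using Qx by simp
      have "absval (poly Q x) = t ^ N"
        unfolding * using lt top by (subst absval_diff_eq_max) auto
      then show ?thesis using t1 by simp
    qed
  qed
  show ?thesis using that 1 2 3 by blast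
qed

text \<open>
  Only finitely many zeros lie in any smaller disk, so their absolute values are easily avoided. The
  bound on \<open>\<bar>w\<^sub>j\<bar>\<^sup>-\<^sup>j\<close> makes the product of the norms of the correction factors finite.
\<close>

lemma radii_avoiding_zeros:
  fixes z :: "nat \<Rightarrow> 'a::{nonarchimedean_field, alg_closed_field}"
  assumes fin: "\<And>\<rho>. \<rho> < 1 \<Longrightarrow> finite {n\<in>C. absval (z n) \<le> \<rho>}"
  obtains w :: "nat \<Rightarrow> 'a" where "\<And>j. absval (w j) < 1" "\<And>j. w j \<noteq> 0"
    "\<And>j. absval (w j) < absval (w (Suc j))" "\<And>j n. n \<in> C \<Longrightarrow> absval (z n) \<noteq> absval (w j)"
    "\<And>j. (1 / absval (w j)) ^ j \<le> exp ((1/2) ^ j)" "(\<lambda>j. absval (w j)) \<longlonglongrightarrow> 1"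
proof -
  \<comment> \<open>Dividing by \<open>j + 1\<close> ensures that \<open>\<bar>w\<^sub>j\<bar> > b\<^sub>j\<close> implies \<open>\<bar>w\<^sub>j\<bar>\<^sup>j \<ge> exp (- 1 / 2\<^sup>j)\<close>.\<close>
  define b where "b = (\<lambda>j::nat. exp (- ((1/2) ^ j / real (Suc j))))"
  have b: "0 < b j" "b j < 1" for j by (auto simp: b_def)
  define good where "good = (\<lambda>j (x::'a). b j < absval x \<and> absval x < 1 \<and> absval x \<notin> (absval \<circ> z) ` C)"
  have ex: "\<exists>x. good j x \<and> a < absval x" if "a < 1" for a j
  proof -
    define a1 where "a1 = max a (b j)"
    have a1: "0 < a1" "a1 < 1" using that b[of j] by (auto simp: a1_def)
    define a2 where "a2 = (a1 + 1) / 2"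
    have a2: "a1 < a2" "a2 < 1" using a1 by (auto simp: a2_def)
    obtain x :: 'a where x: "a1 < absval x" "absval x < a2"
      "absval x \<notin> (absval \<circ> z) ` {n\<in>C. absval (z n) \<le> a2}"
      using absval_dense_avoiding[OF a1(1) a2(1) finite_imageI[OF fin[OF a2(2)]], of "absval \<circ> z"]
      by metis
    have "absval x \<noteq> absval (z n)" if "n \<in> C" for n
    proof
      assume eq: "absval x = absval (z n)"
      then have "n \<in> {n\<in>C. absval (z n) \<le> a2}" using x(2) that by simp
      then have "(absval \<circ> z) n \<in> (absval \<circ> z) ` {n\<in>C. absval (z n) \<le> a2}" by (rule imageI)
      then show False using x(3) eq by simp
    qed
    then have "good j x \<and> a < absval x" using x a2 by (auto simp: good_def a1_def)
    then show ?thesis ..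
  qed
  have "\<exists>w. \<forall>j. good j (w j) \<and> absval (w j) < absval (w (Suc j))"
  proof (rule dependent_nat_choice)
    show "\<exists>x. good 0 x" using ex[of 0 0] by auto
    show "\<exists>y. good (Suc j) y \<and> absval x < absval y" if "good j x" for x j
      using ex[of "absval x" "Suc j"] that by (auto simp: good_def)
  qed
  then obtain w where w: "\<And>j. good j (w j)" "\<And>j. absval (w j) < absval (w (Suc j))" by blast
  have w_bounds: "b j < absval (w j)" "absval (w j) < 1" for j using w(1)[of j] by (auto simp: good_def)
  have w0: "w j \<noteq> 0" for j using w_bounds(1)[of j] b(1)[of j] by auto
  have "(1 / absval (w j)) ^ j \<le> exp ((1/2) ^ j)" for j
  proof -
    have "1 / absval (w j) \<le> 1 / b j" using w_bounds b(1) by (intro divide_left_mono) (auto simp: less_imp_le w0)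
    then have "(1 / absval (w j)) ^ j \<le> (1 / b j) ^ j" by (intro power_mono) auto
    also have "\<dots> = exp (real j * ((1/2) ^ j / real (Suc j)))"
      by (simp only: exp_of_nat_mult b_def exp_minus divide_inverse inverse_inverse_eq mult_1)
    also have "\<dots> \<le> exp ((1/2) ^ j)"
    proof -
      have "real j * ((1/2) ^ j / real (Suc j)) = (real j / real (Suc j)) * (1/2) ^ j" by simp
      also have "\<dots> \<le> 1 * (1/2) ^ j" by (intro mult_right_mono) auto
      finally show ?thesis by simp
    qed
    finally show ?thesis .
  qed
  moreover have "(\<lambda>j. absval (w j)) \<longlonglongrightarrow> 1"
  proof (rule tendsto_sandwich)
    have "(\<lambda>j. exp (- ((1/2::real) ^ j * inverse (real (Suc j))))) \<longlonglongrightarrow> exp (- (0 * 0))"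
      by (intro tendsto_intros LIMSEQ_realpow_zero LIMSEQ_inverse_real_of_nat) auto
    then show "b \<longlonglongrightarrow> 1" by (simp only: b_def divide_inverse mult_zero_left minus_zero exp_zero)
    show "eventually (\<lambda>j. b j \<le> absval (w j)) sequentially" "eventually (\<lambda>j. absval (w j) \<le> 1) sequentially"
      by (intro always_eventually allI less_imp_le w_bounds)+
  qed simp
  moreover have "absval (z n) \<noteq> absval (w j)" if "n \<in> C" for j n
    using w(1)[of j] imageI[OF that, of "absval \<circ> z"] unfolding good_def comp_apply by metis
  ultimately show ?thesis using that w w0 w_bounds(2) by blast
qed

text \<open>
  The product of all the factors \<open>(1 - x / z\<^sub>m) ^ k\<^sub>m\<close> need not converge, because \<open>\<bar>z\<^sub>m\<bar>\<close> tends to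
  \<open>1\<close>. They are therefore gathered in finite blocks, separated by the circles of radius \<open>\<bar>w\<^sub>j\<bar>\<close>, and
  the product \<open>P\<^sub>j\<close> of a block is multiplied by its correction factor \<open>Q\<^sub>j\<close>. As
  \<open>P\<^sub>j Q\<^sub>j = 1 + O(x\<^sup>j)\<close>, the coefficients of the partial products \<open>S\<^sub>J\<close> become stationary and define
  \<open>f\<close>. The price is the additional zeros of the \<open>Q\<^sub>j\<close>, but they lie on circles that avoid every
  \<open>z\<^sub>n\<close>, so that \<open>\<bar>Q\<^sub>j(z\<^sub>n)\<bar> \<ge> 1\<close>.
\<close>

lemma bounded_with_prescribed_zeros:
  fixes z :: "nat \<Rightarrow> 'a::{nonarchimedean_field, alg_closed_field}"
  assumes z: "\<And>n. absval (z n) < 1" and nz: "\<And>n. n \<in> C \<Longrightarrow> z n \<noteq> 0"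
    and fin: "\<And>\<rho>. \<rho> < 1 \<Longrightarrow> finite {n\<in>C. absval (z n) \<le> \<rho>}"
    and \<delta>: "0 < \<delta>" "\<And>A. finite A \<Longrightarrow> A \<subseteq> C \<Longrightarrow> \<delta> \<le> (\<Prod>m\<in>A. absval (z m) ^ k m)"
  obtains f S where "poly_approx S f"
    and "\<And>n. n \<in> C \<Longrightarrow> eventually (\<lambda>J. \<exists>T A. S J = [:1, - inverse (z n):] ^ k n * T
      \<and> finite A \<and> A \<subseteq> C - {n}
      \<and> (\<Prod>m\<in>A. absval (z n - z m) ^ k m) \<le> absval (poly T (z n))) sequentially"
proof -
  obtain w :: "nat \<Rightarrow> 'a" where w: "\<And>j. absval (w j) < 1" "\<And>j. w j \<noteq> 0"
    "\<And>j. absval (w j) < absval (w (Suc j))" "\<And>j n. n \<in> C \<Longrightarrow> absval (z n) \<noteq> absval (w j)"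
    "\<And>j. (1 / absval (w j)) ^ j \<le> exp ((1/2) ^ j)" "(\<lambda>j. absval (w j)) \<longlonglongrightarrow> 1"
    using radii_avoiding_zeros[of C z, OF fin] by metis
  define A where "A = (\<lambda>J. {m\<in>C. absval (z m) < absval (w J)})"
  define Bl where "Bl = (\<lambda>J. {m\<in>C. absval (w J) < absval (z m) \<and> absval (z m) < absval (w (Suc J))})"
  have finA: "finite (A J)" for J
    by (rule finite_subset[OF _ fin[OF w(1)[of J]]]) (auto simp: A_def)
  have finBl: "finite (Bl J)" for J
    by (rule finite_subset[OF _ finA[of "Suc J"]]) (auto simp: A_def Bl_def)
  have A_Suc: "A (Suc J) = A J \<union> Bl J" "A J \<inter> Bl J = {}" for J
    using w(3)[of J] w(4)[of _ J] by (auto simp: A_def Bl_def) (meson linorder_less_linear)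
  define L where "L = (\<lambda>m. [:1, - inverse (z m):] ^ k m)"
  define P where "P = (\<lambda>J. \<Prod>m\<in>Bl J. L m)"
  have "geom_bounded (1 / absval (w J)) (fps_of_poly (P J))" for J
    unfolding P_def L_def fps_of_poly_prod fps_of_poly_power
  proof (intro geom_bounded_prod geom_bounded_power)
    fix m assume "m \<in> Bl J"
    then have "inverse (absval (z m)) \<le> inverse (absval (w J))"
      using w(2) by (intro le_imp_inverse_le) (auto simp: Bl_def less_imp_le)
    then have "absval (coeff [:1, - inverse (z m):] n) \<le> (1 / absval (w J)) ^ n" for n
      by (cases n rule: nat.exhaust[case_product nat.exhaust])
         (auto simp: coeff_pCons absval_inverse divide_inverse split: nat.splits)
    then show "geom_bounded (1 / absval (w J)) (fps_of_poly [:1, - inverse (z m):])"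
      by (simp add: geom_bounded_def)
  qed auto
  then have "\<exists>Q. fps_cutoff J (fps_of_poly (P J * Q)) = fps_cutoff J 1
      \<and> coeffs_le (fps_of_poly Q) ((1 / absval (w J)) ^ J)
      \<and> (\<forall>x. absval x \<noteq> absval (w J) \<longrightarrow> 1 \<le> absval (poly Q x))" for J
    using w(1)[of J] w(2)[of J] by (metis correction_factor less_imp_le)
  then obtain Q where Q: "\<And>J. fps_cutoff J (fps_of_poly (P J * Q J)) = fps_cutoff J 1"
    "\<And>J. coeffs_le (fps_of_poly (Q J)) ((1 / absval (w J)) ^ J)"
    "\<And>J x. absval x \<noteq> absval (w J) \<Longrightarrow> 1 \<le> absval (poly (Q J) x)" by metis
  define S where "S = (\<lambda>J. (\<Prod>m\<in>A J. L m) * (\<Prod>j<J. Q j))"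
  have S_Suc: "S (Suc J) = S J * (P J * Q J)" for J
    unfolding S_def P_def A_Suc(1) prod.union_disjoint[OF finA finBl A_Suc(2)]
    by (simp add: mult_ac)
  have stable1: "coeff (S (Suc J)) i = coeff (S J) i" if "i < J" for i J
  proof -
    have "fps_nth (fps_of_poly (S J) * fps_of_poly (P J * Q J)) i = fps_nth (fps_of_poly (S J) * 1) i"
      using fps_cutoff_right_mult_nth[OF that] Q(1) by metis
    then show ?thesis unfolding S_Suc fps_of_poly_mult[symmetric] by simp
  qed
  have stable: "coeff (S J) i = coeff (S (Suc i)) i" if "Suc i \<le> J" for i J
    using that by (induction rule: dec_induct) (auto simp: stable1)
  define f where "f = Abs_fps (\<lambda>i. coeff (S (Suc i)) i)"
  \<comment> \<open>The linear factors contribute \<open>1 / \<delta>\<close>, the correction factors \<open>exp (\<Sum>j. 2\<^sup>-\<^sup>j) = exp 2\<close>.\<close>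
  have bound: "coeffs_le (fps_of_poly (S J)) (1 / \<delta> * exp 2)" for J
  proof -
    have "coeffs_le (fps_of_poly (L m)) ((1 / absval (z m)) ^ k m)" if "m \<in> A J" for m
      unfolding L_def fps_of_poly_power
    proof (rule coeffs_le_power)
      have "1 \<le> 1 / absval (z m)" using z[of m] nz[of m] that by (auto simp: A_def)
      then show "coeffs_le (fps_of_poly [:1, - inverse (z m):]) (1 / absval (z m))"
        by (auto simp: coeffs_le_def coeff_pCons absval_inverse divide_inverse split: nat.splits)
    qed
    then have "coeffs_le (fps_of_poly (S J)) ((\<Prod>m\<in>A J. (1 / absval (z m)) ^ k m) * (\<Prod>j<J. (1 / absval (w j)) ^ j))"
      unfolding S_def fps_of_poly_mult fps_of_poly_prod
      by (intro coeffs_le_mult coeffs_le_prod Q(2)) auto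
    moreover have "(\<Prod>m\<in>A J. (1 / absval (z m)) ^ k m) \<le> 1 / \<delta>"
    proof -
      have "(\<Prod>m\<in>A J. (1 / absval (z m)) ^ k m) = inverse (\<Prod>m\<in>A J. absval (z m) ^ k m)"
        by (simp add: prod_inversef[symmetric] power_inverse divide_inverse comp_def)
      also have "\<dots> \<le> inverse \<delta>"
        using \<delta> finA[of J] by (intro le_imp_inverse_le) (auto simp: A_def)
      finally show ?thesis by (simp add: divide_inverse)
    qed
    moreover have "(\<Prod>j<J. (1 / absval (w j)) ^ j) \<le> exp 2"
    proof -
      have "(\<Prod>j<J. (1 / absval (w j)) ^ j) \<le> (\<Prod>j<J. exp ((1/2) ^ j))"
        using w(5) by (intro prod_mono) auto
      also have "\<dots> = exp (\<Sum>j<J. (1/2) ^ j)" by (simp add: exp_sum)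
      also have "(\<Sum>j<J. (1/2::real) ^ j) \<le> 2"
        by (simp add: sum_gp_strict)
      finally show ?thesis by simp
    qed
    ultimately show ?thesis
      using \<delta>(1) by (elim coeffs_le_mono) (intro mult_mono, auto intro!: prod_nonneg)
  qed
  have "fps_cutoff N (fps_of_poly (S N)) = fps_cutoff N f" for N
    unfolding fps_cutoff_eq_fps_cutoff_iff f_def fps_of_poly_nth fps_nth_Abs_fps
    using stable Suc_leI by blast
  moreover have "coeffs_le f (1 / \<delta> * exp 2)"
    unfolding coeffs_le_def f_def using coeffs_leD[OF bound] by simp
  ultimately have approx: "poly_approx S f"
    using bound unfolding poly_approx_def by blast
  have "eventually (\<lambda>J. \<exists>T A. S J = [:1, - inverse (z n):] ^ k n * T
      \<and> finite A \<and> A \<subseteq> C - {n}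
      \<and> (\<Prod>m\<in>A. absval (z n - z m) ^ k m) \<le> absval (poly T (z n))) sequentially" if n: "n \<in> C" for n
    using order_tendstoD(1)[OF w(6) z[of n]]
  proof eventually_elim
    case (elim J)
    then have nA: "n \<in> A J" using n by (simp add: A_def)
    define T where "T = (\<Prod>m\<in>A J - {n}. L m) * (\<Prod>j<J. Q j)"
    have "S J = L n * T" unfolding S_def T_def prod.remove[OF finA nA] by (simp add: mult_ac)
    moreover have "(\<Prod>m\<in>A J - {n}. absval (z n - z m) ^ k m) \<le> absval (poly T (z n))"
    proof -
      have factor: "absval (z n - z m) ^ k m \<le> absval (poly (L m) (z n))" if "m \<in> A J - {n}" for m
      proof -
        have zm: "z m \<noteq> 0" using that nz by (simp add: A_def)
        have "poly [:1, - inverse (z m):] (z n) = (z m - z n) / z m"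
          using zm by (simp add: field_simps)
        then have "absval (poly (L m) (z n)) = (absval (z n - z m) / absval (z m)) ^ k m"
          by (simp add: L_def absval_power absval_divide absval_minus_commute)
        moreover have "absval (z n - z m) * 1 \<le> absval (z n - z m) / absval (z m)"
          unfolding divide_inverse using z[of m] zm
          by (intro mult_left_mono) (auto simp: one_le_inverse_iff less_imp_le)
        ultimately show ?thesis by (simp add: power_mono)
      qed
      have "(\<Prod>m\<in>A J - {n}. absval (z n - z m) ^ k m) * 1
          \<le> (\<Prod>m\<in>A J - {n}. absval (poly (L m) (z n))) * (\<Prod>j<J. absval (poly (Q j) (z n)))"
        using factor Q(3) w(4)[OF n]
        by (intro mult_mono prod_mono prod_ge_1) (auto intro!: prod_nonneg)
      then show ?thesis by (simp add: T_def poly_prod absval_mult absval_prod)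
    qed
    moreover have "finite (A J - {n})" "A J - {n} \<subseteq> C - {n}" using finA by (auto simp: A_def)
    ultimately show ?case unfolding L_def by blast
  qed
  then show ?thesis using that approx by blast
qed

section \<open>Separating the points of the path\<close>

lemma nonprincipal_ultrafilter_avoids_finite:
  assumes u: "nonprincipal_ultrafilter u" and A: "finite A"
  shows "eventually (\<lambda>n. n \<notin> A) u"
  using A
proof induction
  case (insert a A)
  have "eventually (\<lambda>n. n \<noteq> a) u"
  proof (rule ccontr)
    assume "\<not> ?thesis"
    then have ev: "eventually (\<lambda>n. n = a) u"
      using u unfolding nonprincipal_ultrafilter_def by fastforce
    have "u = principal {a}"
    proof (rule filter_eqI)
      fix P
      have "eventually P u \<longleftrightarrow> P a"
      proof
        assume "eventually P u"
        with ev have "eventually (\<lambda>n. P a) u" by eventually_elim auto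
        then show "P a" using u by (simp add: nonprincipal_ultrafilter_def eventually_const)
      next
        assume "P a"
        then show "eventually P u" using ev by (auto elim: eventually_mono)
      qed
      then show "eventually P u \<longleftrightarrow> eventually P (principal {a})" by (simp add: eventually_principal)
    qed
    then show False using u by (simp add: nonprincipal_ultrafilter_def)
  qed
  with insert.IH show ?case by eventually_elim auto
qed simp

lemma weighted_separation_le_prod:
  assumes z: "\<And>n. absval (z n) < 1" and A: "finite A" "A \<subseteq> C - {n}"
  shows "weighted_separation z k C n \<le> (\<Prod>m\<in>A. absval (z n - z m) ^ k m)"
    and "0 \<le> weighted_separation z k C n"
proof -
  define B where "B = (\<lambda>N. {m \<in> C. m < N \<and> m \<noteq> n})"
  define X where "X = (\<lambda>N. \<Prod>m\<in>B N. absval (z n - z m) ^ k m)"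
  have fac: "absval (z n - z m) ^ k m \<le> 1" for m
    using absval_diff_le[of "z n" 1 "z m"] z[of n] z[of m] by (intro power_le_one) auto
  have anti: "prod f T \<le> prod f S" if "S \<subseteq> T" "finite T" and f: "f = (\<lambda>m. absval (z n - z m) ^ k m)"
    for S T :: "nat set" and f
  proof -
    have "prod f T = prod f (T - S) * prod f S" using that by (intro prod.subset_diff)
    also have "\<dots> \<le> 1 * prod f S"
      using fac unfolding f by (intro mult_right_mono prod_le_1 prod_nonneg) auto
    finally show ?thesis by simp
  qed
  have dec: "decseq X" unfolding X_def by (intro decseq_SucI anti) (auto simp: B_def)
  have X0: "0 \<le> X N" for N unfolding X_def by (intro prod_nonneg) auto
  obtain L where L: "X \<longlonglongrightarrow> L" using decseq_convergent[OF dec, of 0] X0 by blast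
  have "weighted_separation z k C n = lim X"
    unfolding weighted_separation_def X_def B_def ..
  with L have lim: "X \<longlonglongrightarrow> weighted_separation z k C n" by (simp add: limI)
  show "0 \<le> weighted_separation z k C n" using X0 by (intro LIMSEQ_le_const[OF lim]) auto
  obtain N where N: "A \<subseteq> {..<N}" using finite_nat_iff_bounded A(1) by blast
  have "weighted_separation z k C n \<le> X N" using decseq_ge[OF dec lim] .
  also have "\<dots> \<le> (\<Prod>m\<in>A. absval (z n - z m) ^ k m)"
    unfolding X_def using A N by (intro anti) (auto simp: B_def)
  finally show "weighted_separation z k C n \<le> \<dots>" .
qed

text \<open>
  The supremum over \<open>D\<^sup>+(c, \<rho>)\<close>, \<open>\<rho> ^ k = r\<close>, is multiplicative. The factor of order \<open>k\<close> at \<open>c\<close>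
  contributes \<open>r / \<bar>c\<bar> ^ k\<close> to it, and the contribution of the cofactor increases with \<open>r\<close>.
\<close>

lemma zeta_disk_vanishing:
  fixes c :: "'a::{nonarchimedean_field, complete_space, alg_closed_field}"
  assumes S: "poly_approx S f"
    and T: "eventually (\<lambda>J. \<exists>T. S J = [:1, - inverse c:] ^ k * T \<and> \<delta> \<le> absval (poly T c)) sequentially"
    and c: "absval c < 1" "c \<noteq> 0" and k: "1 \<le> k" and r: "0 < r" "r \<le> s" "s < 1"
  shows "r * \<delta> \<le> zeta_disk (cball c (root k r)) f"
    and "s * zeta_disk (cball c (root k r)) f \<le> r * zeta_disk (cball c (root k s)) f"
proof -
  have root: "0 < root k t" "root k t < 1" "root k t ^ k = t" if "0 < t" "t < 1" for t
    using k that by auto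
  have lim: "(\<lambda>J. poly_sup c (root k t) (S J)) \<longlonglongrightarrow> zeta_disk (cball c (root k t)) f"
    if "0 < t" "t < 1" for t using poly_approx_tendsto_zeta_disk[OF S c(1)] root that by auto
  have factor: "poly_sup c (root k t) ([:1, - inverse c:] ^ k * T) = t / absval c ^ k * poly_sup c (root k t) T"
    if t: "0 < t" "t < 1" for t T
    using root[OF t] c(2) by (simp add: poly_sup_mult poly_sup_power poly_sup_linear_center power_divide)
  have c_pow: "0 < absval c ^ k" "absval c ^ k \<le> 1" using c by (auto intro: power_le_one)
  have r1: "r < 1" and s0: "0 < s" using r by auto
  have "eventually (\<lambda>J. r * \<delta> \<le> poly_sup c (root k r) (S J)) sequentially"
    using T
  proof eventually_elim
    case (elim J)
    then obtain T where T: "S J = [:1, - inverse c:] ^ k * T" "\<delta> \<le> absval (poly T c)" by blast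
    have sup: "\<delta> \<le> poly_sup c (root k r) T"
      using T(2) poly_sup_ge_center[OF root(1)[OF r(1) r1]] order_trans by blast
    have "0 \<le> poly_sup c (root k r) T"
      using poly_sup_ge_center[OF root(1)[OF r(1) r1]] absval_nonneg order_trans by blast
    then have "r * poly_sup c (root k r) T \<le> r / absval c ^ k * poly_sup c (root k r) T"
      using c_pow r by (intro mult_right_mono) (auto simp: field_simps)
    moreover have "r * \<delta> \<le> r * poly_sup c (root k r) T" using sup r by simp
    ultimately show ?case unfolding T(1) factor[OF r(1) r1] by linarith
  qed
  then show "r * \<delta> \<le> zeta_disk (cball c (root k r)) f"
    by (intro tendsto_lowerbound[OF lim[OF r(1) r1]]) auto
  have "eventually (\<lambda>J. s * poly_sup c (root k r) (S J) \<le> r * poly_sup c (root k s) (S J)) sequentially"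
    using T
  proof eventually_elim
    case (elim J)
    then obtain T where T: "S J = [:1, - inverse c:] ^ k * T" by blast
    have "poly_sup c (root k r) T \<le> poly_sup c (root k s) T"
      using r k by (intro poly_sup_mono) auto
    then show ?case
      unfolding T factor[OF r(1) r1] factor[OF s0 r(3)]
      using mult_left_mono[of "poly_sup c (root k r) T" "poly_sup c (root k s) T" "r * s / absval c ^ k"] r c_pow
      by (simp add: mult_ac)
  qed
  then show "s * zeta_disk (cball c (root k r)) f \<le> r * zeta_disk (cball c (root k s)) f"
    by (intro tendsto_le[OF _ tendsto_mult_left[OF lim[OF s0 r(3)]] tendsto_mult_left[OF lim[OF r(1) r1]]]) auto
qed

text \<open>
  The product condition at a single \<open>z\<^bsub>n0\<^esub>\<close> forces the \<open>z\<^sub>m\<close>, \<open>m \<in> C\<close>, towards the unit circle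
  fast enough for a bounded function to vanish at them to the orders \<open>k\<^sub>m\<close>. The product condition
  at the other points bounds the cofactors of these zeros away from \<open>0\<close>. The two conclusions make the value at \<open>f\<close> strictly increasing in \<open>r\<close>:
  divided by \<open>r\<close>, it is still increasing, and it is positive.
\<close>

lemma compatible_separating_function:
  fixes z :: "nat \<Rightarrow> 'a::{nonarchimedean_field, complete_space, alg_closed_field}"
  assumes u: "nonprincipal_ultrafilter u" and z: "\<And>n. absval (z n) < 1"
    and comp: "k \<in> compatible_seqs u z"
  obtains f \<delta> where "f \<in> Hinf" "0 < \<delta>"
    "\<And>r. 0 < r \<Longrightarrow> r < 1 \<Longrightarrow> r * \<delta> \<le> zeta z u k r f"
    "\<And>r s. 0 < r \<Longrightarrow> r \<le> s \<Longrightarrow> s < 1 \<Longrightarrow> s * zeta z u k r f \<le> r * zeta z u k s f"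
proof -
  have k: "1 \<le> k n" for n using comp by (simp add: compatible_seqs_def)
  obtain C0 where C0: "eventually (\<lambda>n. n \<in> C0) u" "0 < (INF n\<in>C0. weighted_separation z k C0 n)"
    using comp by (auto simp: compatible_seqs_def)
  define \<delta> where "\<delta> = (INF n\<in>C0. weighted_separation z k C0 n)"
  have \<delta>: "0 < \<delta>" using C0 by (simp add: \<delta>_def)
  have sep: "\<delta> \<le> (\<Prod>m\<in>A. absval (z n - z m) ^ k m)" if "n \<in> C0" "finite A" "A \<subseteq> C0 - {n}" for n A
  proof -
    have "\<delta> \<le> weighted_separation z k C0 n"
      unfolding \<delta>_def using that(1) weighted_separation_le_prod(2)[OF z, of "{}"]
      by (intro cINF_lower bdd_belowI[of _ 0]) auto
    also have "\<dots> \<le> (\<Prod>m\<in>A. absval (z n - z m) ^ k m)"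
      by (rule weighted_separation_le_prod(1)[OF z that(2,3)])
    finally show ?thesis .
  qed
  have "C0 \<noteq> {}" using C0(1) u by (auto simp: nonprincipal_ultrafilter_def)
  then obtain n0 where n0: "n0 \<in> C0" by blast
  \<comment> \<open>The factors of points in a smaller disk are bounded by some \<open>\<rho>' < 1\<close>, so that too many of them
    would push the product below \<open>\<delta>\<close>.\<close>
  have fin0: "finite {n\<in>C0. absval (z n) \<le> \<rho>}" if \<rho>: "\<rho> < 1" for \<rho>
  proof (rule ccontr)
    assume "infinite {n\<in>C0. absval (z n) \<le> \<rho>}"
    then have inf: "infinite ({n\<in>C0. absval (z n) \<le> \<rho>} - {n0})" by simp
    define \<rho>' where "\<rho>' = max (absval (z n0)) \<rho>"
    have \<rho>': "0 \<le> \<rho>'" "\<rho>' < 1" using z \<rho> by (auto simp: \<rho>'_def max.coboundedI1)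
    obtain M where M: "\<rho>' ^ M < \<delta>" using real_arch_pow_inv[OF \<delta> \<rho>'(2)] by blast
    obtain A where A: "finite A" "card A = M" "A \<subseteq> {n\<in>C0. absval (z n) \<le> \<rho>} - {n0}"
      using infinite_arbitrarily_large[OF inf] by blast
    have "\<delta> \<le> (\<Prod>m\<in>A. absval (z n0 - z m) ^ k m)" using A by (intro sep[OF n0]) auto
    also have "\<dots> \<le> (\<Prod>m\<in>A. \<rho>')"
    proof (intro prod_mono conjI)
      fix m assume m: "m \<in> A"
      have "absval (z n0 - z m) \<le> \<rho>'"
        using m A(3) by (intro absval_diff_le) (auto simp: \<rho>'_def max.coboundedI2)
      then have "absval (z n0 - z m) ^ k m \<le> \<rho>' ^ k m" by (intro power_mono) auto
      also have "\<dots> \<le> \<rho>' ^ 1" using \<rho>' k by (intro power_decreasing) auto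
      finally show "absval (z n0 - z m) ^ k m \<le> \<rho>'" by simp
    qed auto
    finally show False using A M by simp
  qed
  \<comment> \<open>Only finitely many indices are lost, and those which remain satisfy \<open>\<bar>z\<^sub>n\<^sub>0 - z\<^sub>n\<bar> = \<bar>z\<^sub>n\<bar>\<close>.\<close>
  define C where "C = {n\<in>C0. absval (z n0) < absval (z n)}"
  have fin: "finite {n\<in>C. absval (z n) \<le> \<rho>}" if "\<rho> < 1" for \<rho>
    by (rule finite_subset[OF _ fin0[OF that]]) (auto simp: C_def)
  have C_u: "eventually (\<lambda>n. n \<in> C) u"
    using C0(1) nonprincipal_ultrafilter_avoids_finite[OF u fin0[OF z[of n0]]]
    by eventually_elim (auto simp: C_def)
  have nz: "z n \<noteq> 0" if "n \<in> C" for n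
    using that absval_nonneg[of "z n0"] by (auto simp: C_def simp del: absval_nonneg)
  have prod_z: "\<delta> \<le> (\<Prod>m\<in>A. absval (z m) ^ k m)" if A: "finite A" "A \<subseteq> C" for A
  proof -
    have "\<delta> \<le> (\<Prod>m\<in>A. absval (z n0 - z m) ^ k m)"
      using A by (intro sep[OF n0]) (auto simp: C_def)
    also have "\<dots> = (\<Prod>m\<in>A. absval (z m) ^ k m)"
      using A by (intro prod.cong refl) (subst absval_diff_eq_max, auto simp: C_def)
    finally show ?thesis .
  qed
  obtain f S where f: "poly_approx S f"
    and S: "\<And>n. n \<in> C \<Longrightarrow> eventually (\<lambda>J. \<exists>T A. S J = [:1, - inverse (z n):] ^ k n * T
      \<and> finite A \<and> A \<subseteq> C - {n}
      \<and> (\<Prod>m\<in>A. absval (z n - z m) ^ k m) \<le> absval (poly T (z n))) sequentially"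
    by (rule bounded_with_prescribed_zeros[of z C \<delta> k, OF z nz fin \<delta> prod_z], assumption+, rule that)
  have S': "eventually (\<lambda>J. \<exists>T. S J = [:1, - inverse (z n):] ^ k n * T \<and> \<delta> \<le> absval (poly T (z n))) sequentially"
    if n: "n \<in> C" for n
    using S[OF n]
  proof (rule eventually_mono)
    fix J assume "\<exists>T A. S J = [:1, - inverse (z n):] ^ k n * T \<and> finite A \<and> A \<subseteq> C - {n}
      \<and> (\<Prod>m\<in>A. absval (z n - z m) ^ k m) \<le> absval (poly T (z n))"
    then obtain T A where TA: "S J = [:1, - inverse (z n):] ^ k n * T" "finite A" "A \<subseteq> C - {n}"
      "(\<Prod>m\<in>A. absval (z n - z m) ^ k m) \<le> absval (poly T (z n))" by blast
    have "\<delta> \<le> (\<Prod>m\<in>A. absval (z n - z m) ^ k m)"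
      using n TA by (intro sep) (auto simp: C_def)
    with TA show "\<exists>T. S J = [:1, - inverse (z n):] ^ k n * T \<and> \<delta> \<le> absval (poly T (z n))"
      by (meson order_trans)
  qed
  have fH: "f \<in> Hinf" using f by (auto simp: poly_approx_def intro: HinfI)
  have ubot: "u \<noteq> bot" using u by (simp add: nonprincipal_ultrafilter_def)
  note lim = zeta_tendsto[OF u z k fH]
  have "r * \<delta> \<le> zeta z u k r f" if r: "0 < r" "r < 1" for r
  proof (rule tendsto_lowerbound[OF lim[OF r] _ ubot])
    show "eventually (\<lambda>n. r * \<delta> \<le> zeta_disk (cball (z n) (root (k n) r)) f) u"
      using C_u by (rule eventually_mono) (use zeta_disk_vanishing(1)[OF f S' z nz k r(1) order_refl r(2)] in blast)
  qed
  moreover have "s * zeta z u k r f \<le> r * zeta z u k s f" if r: "0 < r" "r \<le> s" "s < 1" for r s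
  proof -
    have r1: "r < 1" and s0: "0 < s" using r by auto
    have "eventually (\<lambda>n. s * zeta_disk (cball (z n) (root (k n) r)) f
        \<le> r * zeta_disk (cball (z n) (root (k n) s)) f) u"
      using C_u by (rule eventually_mono) (use zeta_disk_vanishing(2)[OF f S' z nz k r] in blast)
    then show ?thesis
      by (rule tendsto_le[OF ubot tendsto_mult_left[OF lim[OF s0 r(3)]] tendsto_mult_left[OF lim[OF r(1) r1]]])
  qed
  ultimately show ?thesis using that fH \<delta> by blast
qed

lemma strict_mono_on_closed_interval:
  fixes \<phi> :: "real \<Rightarrow> real"
  assumes cont: "continuous_on {0..1} \<phi>"
    and strict: "\<And>r s. 0 < r \<Longrightarrow> r < s \<Longrightarrow> s < 1 \<Longrightarrow> \<phi> r < \<phi> s"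
  shows "strict_mono_on {0..1} \<phi>"
proof -
  have 0: "\<phi> 0 < \<phi> s" if s: "0 < s" "s < 1" for s
  proof -
    have "\<phi> 0 \<le> \<phi> (s / 2)"
    proof (rule tendsto_upperbound)
      show "(\<phi> \<longlongrightarrow> \<phi> 0) (at_right 0)"
        using cont by (simp add: continuous_on_Icc_at_rightD)
      show "eventually (\<lambda>r. \<phi> r \<le> \<phi> (s / 2)) (at_right 0)"
        using s by (intro eventually_at_rightI[of 0 "s / 2"]) (auto intro!: less_imp_le strict)
    qed simp
    also have "\<dots> < \<phi> s" using s by (intro strict) auto
    finally show ?thesis .
  qed
  have 1: "\<phi> r < \<phi> 1" if r: "0 < r" "r < 1" for r
  proof -
    have "\<phi> r < \<phi> ((r + 1) / 2)" using r by (intro strict) auto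
    also have "\<dots> \<le> \<phi> 1"
    proof (rule tendsto_lowerbound)
      show "(\<phi> \<longlongrightarrow> \<phi> 1) (at_left 1)"
        using cont by (simp add: continuous_on_Icc_at_leftD)
      show "eventually (\<lambda>s. \<phi> ((r + 1) / 2) \<le> \<phi> s) (at_left 1)"
        using r by (intro eventually_at_leftI[of "(r + 1) / 2"]) (auto intro!: less_imp_le strict)
    qed simp
    finally show ?thesis .
  qed
  have "\<phi> r < \<phi> s" if "0 \<le> r" "r < s" "s \<le> 1" for r s
    using that 0[of s] 1[of r] strict[of r s] 0[of "1/2"] 1[of "1/2"]
    by (cases "r = 0"; cases "s = 1") auto
  then show ?thesis by (auto simp: strict_mono_on_def)
qed

theorem theorem2p4:
  fixes z :: "nat \<Rightarrow> 'a::{nonarchimedean_field, complete_space, alg_closed_field}"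
    and u :: "nat filter" and k :: "nat \<Rightarrow> nat"
  assumes "nonprincipal_ultrafilter u"
    and "\<forall>n. absval (z n) < 1"
    and "regular_seq u z"
    and "k \<in> compatible_seqs u z"
  shows "\<exists>\<zeta>0 \<zeta>1. \<zeta>0 \<in> Berk \<and> \<zeta>1 \<in> Berk \<and>
    limitin Berk_topology (zeta z u k) \<zeta>0 (at_right 0) \<and>
    limitin Berk_topology (zeta z u k) \<zeta>1 (at_left 1) \<and>
    Berk_topology closure_of (zeta z u k ` {0<..<1}) = zeta z u k ` {0<..<1} \<union> {\<zeta>0, \<zeta>1} \<and>
    (\<exists>h. homeomorphic_map
           (subtopology Berk_topology (Berk_topology closure_of (zeta z u k ` {0<..<1})))
           (top_of_set {0..1::real}) h \<and>
         h ` (zeta z u k ` {0<..<1}) = {0<..<1})"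
proof -
  note u = assms(1)
  have z: "absval (z n) < 1" for n using assms(2) by blast
  have k: "1 \<le> k n" for n using assms(4) by (simp add: compatible_seqs_def)
  obtain \<gamma> where \<gamma>: "\<And>r. 0 < r \<Longrightarrow> r < 1 \<Longrightarrow> \<gamma> r = zeta z u k r"
    "\<And>r. 0 \<le> r \<Longrightarrow> r \<le> 1 \<Longrightarrow> \<gamma> r \<in> Berk"
    "\<And>f. f \<in> Hinf \<Longrightarrow> continuous_on {0..1} (\<lambda>r. \<gamma> r f)"
    "continuous_map (top_of_set {0..1}) Berk_topology \<gamma>"
    by (rule zeta_extended_path[of u z k, OF u z k], rule that)
  obtain f \<delta> where f: "f \<in> Hinf" "0 < \<delta>"
    "\<And>r. 0 < r \<Longrightarrow> r < 1 \<Longrightarrow> r * \<delta> \<le> zeta z u k r f"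
    "\<And>r s. 0 < r \<Longrightarrow> r \<le> s \<Longrightarrow> s < 1 \<Longrightarrow> s * zeta z u k r f \<le> r * zeta z u k s f"
    by (rule compatible_separating_function[of u z k, OF u z assms(4)], rule that)
  have "\<gamma> r f < \<gamma> s f" if r: "0 < r" "r < s" "s < 1" for r s
  proof -
    have pos: "0 < zeta z u k r f" using f(2) f(3)[of r] r by (smt (verit) mult_pos_pos)
    have "r * zeta z u k r f < s * zeta z u k r f" using pos r by simp
    also have "\<dots> \<le> r * zeta z u k s f" using f(4)[of r s] r by simp
    finally show ?thesis using r \<gamma>(1)[of r] \<gamma>(1)[of s] by simp
  qed
  then have "strict_mono_on {0..1} (\<lambda>r. \<gamma> r f)"
    by (intro strict_mono_on_closed_interval \<gamma>(3) f(1))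
  then have inj: "inj_on \<gamma> {0..1}"
    by (metis (mono_tags, lifting) inj_onI inj_onD strict_mono_on_imp_inj_on)
  have "Hausdorff_space (Berk_topology :: ('a fps \<Rightarrow> real) topology)"
    unfolding Berk_topology_def
    by (intro Hausdorff_space_subtopology) (simp add: Hausdorff_space_product_topology)
  note arc = arc_in_Hausdorff_space[OF this \<gamma>(4) inj]
  have interior: "\<gamma> ` {0<..<1} = zeta z u k ` {0<..<1}" using \<gamma>(1) by (intro image_cong) auto
  have "{0..1::real} = {0<..<1} \<union> {0, 1}" by auto
  then have closed: "\<gamma> ` {0..1} = zeta z u k ` {0<..<1} \<union> {\<gamma> 0, \<gamma> 1}"
    by (simp only: image_Un interior) simp
  have "limitin Berk_topology (zeta z u k) (\<gamma> 0) (at_right 0)"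
    by (rule limitin_transform_eventually[OF _ arc(3)])
       (auto intro!: eventually_at_rightI[of _ 1] \<gamma>(1))
  moreover have "limitin Berk_topology (zeta z u k) (\<gamma> 1) (at_left 1)"
    by (rule limitin_transform_eventually[OF _ arc(4)])
       (auto intro!: eventually_at_leftI[of 0] \<gamma>(1))
  moreover have "Berk_topology closure_of (zeta z u k ` {0<..<1}) = \<gamma> ` {0..1}"
    using arc(1) by (simp only: interior)
  ultimately show ?thesis
    using \<gamma>(2)[of 0] \<gamma>(2)[of 1] arc(2) closed interior
    by (intro exI[of _ "\<gamma> 0"] exI[of _ "\<gamma> 1"]) simp
qed

end
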